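(* Given an instance $(G,k,\gamma)$ of \textsc{Red-Blue Reinforcement}, where $G$ is a red-blue graph on $n$ vertices, together with a clique-width expression of $G$ using at most $cw$ labels, one can decide whether $(G,k,\gamma)$ is a yes-instance in time $4^{cw}n^{O(1)}$.
   Context: A red-blue graph is a graph $G=(V,E)$ together with sets $R,B\subseteq V$ with $V=R\cup B$ (not necessarily disjoint); vertices of $R$ are red, vertices of $B$ are blue. For $v\in V$, $N[v]$ is the closed neighborhood of $v$. The red-blue domination number $\gamma_{rb}(G)$ is the minimum size of a set $D\subseteq R$ such that $N[v]\cap D\neq\emptyset$ for every $v\in B$. For $S\subseteq V$, $G[V\setminus S]$ is the induced subgraph (with red and blue sets $R\setminus S$, $B\setminus S$). \textsc{Red-Blue Reinforcement}: given a red-blue graph $G$ and integers $k,\gamma$ (where $\gamma=\gamma_{rb}(G)-\alpha$ for a positive integer $\alpha$), decide whether there exists $S\subseteq B$ with $|S|\le k$ and $\gamma_{rb}(G[V\setminus S])\le\gamma$. A clique-width expression with at most $cw$ labels constructs a vertex-labeled graph (labels in $[cw]$) using the operations: (1) create a new single vertex with a label $\ell$; (2) rename all vertices of label $\ell$ to label $\ell'$; (3) add all edges between vertices of label $\ell$ and vertices of label $\ell'$ ($\ell\ne\ell'$); (4) take the disjoint union of two labeled graphs. It is an expression of $G$ if the resulting graph, ignoring labels, is $G$. *)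

theory Defs
  imports Main "HOL-Library.Extended_Nat"
begin

section \<open>Red-blue graphs and Red-Blue Reinforcement\<close>

text \<open>Finite simple undirected graphs; an edge is a two-element set of vertices.\<close>

record rbgraph =
  verts :: "nat set"
  edges :: "nat set set"
  red :: "nat set"
  blue :: "nat set"

definition red_blue_graph :: "rbgraph \<Rightarrow> bool" where
  "red_blue_graph G \<longleftrightarrow> finite (verts G)
     \<and> (\<forall>e\<in>edges G. e \<subseteq> verts G \<and> card e = 2)
     \<and> verts G = red G \<union> blue G"

definition closed_nbh :: "rbgraph \<Rightarrow> nat \<Rightarrow> nat set" where
  "closed_nbh G v = insert v {u \<in> verts G. {u, v} \<in> edges G}"

definition rb_dominating :: "rbgraph \<Rightarrow> nat set \<Rightarrow> bool" where
  "rb_dominating G D \<longleftrightarrow> D \<subseteq> red G \<and> (\<forall>v\<in>blue G. closed_nbh G v \<inter> D \<noteq> {})"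

text \<open>A red-blue graph need not have any red-blue dominating set; in that case the infimum
  over the empty set yields \<open>\<infinity>\<close>.\<close>

definition gamma_rb :: "rbgraph \<Rightarrow> enat" where
  "gamma_rb G = (INF D\<in>{D. rb_dominating G D}. enat (card D))"

definition delete_verts :: "rbgraph \<Rightarrow> nat set \<Rightarrow> rbgraph" where
  "delete_verts G S =
     \<lparr>verts = verts G - S, edges = {e \<in> edges G. e \<subseteq> verts G - S},
      red = red G - S, blue = blue G - S\<rparr>"

text \<open>The condition on \<open>\<gamma>\<close> forces \<open>gamma_rb G\<close> to be finite; \<open>\<gamma>\<close> and \<open>k\<close> may be negative.\<close>

definition rb_reinforcement_instance :: "rbgraph \<Rightarrow> int \<Rightarrow> int \<Rightarrow> bool" where
  "rb_reinforcement_instance G k \<gamma> \<longleftrightarrow> red_blue_graph G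
     \<and> (\<exists>g \<alpha>. gamma_rb G = enat g \<and> \<alpha> > 0 \<and> \<gamma> = int g - \<alpha>)"

definition rb_reinforcement_yes :: "rbgraph \<Rightarrow> int \<Rightarrow> int \<Rightarrow> bool" where
  "rb_reinforcement_yes G k \<gamma> \<longleftrightarrow>
     (\<exists>S\<subseteq>blue G. int (card S) \<le> k
        \<and> (\<exists>m. gamma_rb (delete_verts G S) = enat m \<and> int m \<le> \<gamma>))"


section \<open>Clique-width expressions\<close>

text \<open>A vertex-creating operation carries the name of the created vertex, so that the
  constructed graph can be compared with \<open>G\<close> itself.\<close>

datatype cw_expr =
    Create nat nat            \<comment> \<open>vertex, label\<close>
  | Rename nat nat cw_expr    \<comment> \<open>old label, new label\<close>
  | Join nat nat cw_expr
  | Disj_Union cw_expr cw_expr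

fun cw_verts :: "cw_expr \<Rightarrow> nat set" where
  "cw_verts (Create v l) = {v}"
| "cw_verts (Rename l l' e) = cw_verts e"
| "cw_verts (Join l l' e) = cw_verts e"
| "cw_verts (Disj_Union e1 e2) = cw_verts e1 \<union> cw_verts e2"

text \<open>The value of \<open>cw_label e\<close> is only meaningful on \<open>cw_verts e\<close>.\<close>

fun cw_label :: "cw_expr \<Rightarrow> nat \<Rightarrow> nat" where
  "cw_label (Create v l) u = l"
| "cw_label (Rename l l' e) u = (if cw_label e u = l then l' else cw_label e u)"
| "cw_label (Join l l' e) u = cw_label e u"
| "cw_label (Disj_Union e1 e2) u = (if u \<in> cw_verts e1 then cw_label e1 u else cw_label e2 u)"

fun cw_edges :: "cw_expr \<Rightarrow> nat set set" where
  "cw_edges (Create v l) = {}"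
| "cw_edges (Rename l l' e) = cw_edges e"
| "cw_edges (Join l l' e) = cw_edges e \<union>
     {{u, v} | u v. u \<in> cw_verts e \<and> v \<in> cw_verts e \<and> cw_label e u = l \<and> cw_label e v = l'}"
| "cw_edges (Disj_Union e1 e2) = cw_edges e1 \<union> cw_edges e2"

fun cw_wf :: "nat \<Rightarrow> cw_expr \<Rightarrow> bool" where
  "cw_wf cw (Create v l) \<longleftrightarrow> l \<in> {1..cw}"
| "cw_wf cw (Rename l l' e) \<longleftrightarrow> l \<in> {1..cw} \<and> l' \<in> {1..cw} \<and> cw_wf cw e"
| "cw_wf cw (Join l l' e) \<longleftrightarrow> l \<in> {1..cw} \<and> l' \<in> {1..cw} \<and> l \<noteq> l' \<and> cw_wf cw e"
| "cw_wf cw (Disj_Union e1 e2) \<longleftrightarrow> cw_verts e1 \<inter> cw_verts e2 = {} \<and> cw_wf cw e1 \<and> cw_wf cw e2"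

definition cw_expr_of :: "nat \<Rightarrow> cw_expr \<Rightarrow> rbgraph \<Rightarrow> bool" where
  "cw_expr_of cw e G \<longleftrightarrow> cw_wf cw e \<and> cw_verts e = verts G \<and> cw_edges e = edges G"

fun cw_length :: "cw_expr \<Rightarrow> nat" where
  "cw_length (Create v l) = 1"
| "cw_length (Rename l l' e) = Suc (cw_length e)"
| "cw_length (Join l l' e) = Suc (cw_length e)"
| "cw_length (Disj_Union e1 e2) = Suc (cw_length e1 + cw_length e2)"


section \<open>Model of computation\<close>

text \<open>Algorithms are programs of a first-order functional language over binary trees of cons
  cells (pure Lisp without atoms other than the empty tree). A program is a list of function
  bodies, the first one being the main function. Variables are de Bruijn indices into the
  environment, which for a function body is the list of arguments.

  Time is the number of evaluation steps. Every step inspects or allocates at most one cell or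
  manipulates an environment whose size depends on the program only. So a run of \<open>t\<close> steps
  takes \<open>O(t)\<close> operations on a random access machine: there is no arithmetic, and no comparison
  of trees other than the test for emptiness.\<close>

datatype tree = Leaf | Node tree tree

fun hd_tree :: "tree \<Rightarrow> tree" where
  "hd_tree Leaf = Leaf"
| "hd_tree (Node a b) = a"

fun tl_tree :: "tree \<Rightarrow> tree" where
  "tl_tree Leaf = Leaf"
| "tl_tree (Node a b) = b"

datatype exp =
    Var nat
  | Empty
  | Cell exp exp
  | Hd exp
  | Tl exp
  | Ifnode exp exp exp
  | Bind exp exp
  | Call nat "exp list"

type_synonym program = "exp list"

text \<open>\<open>eval P env e v t\<close>: in program \<open>P\<close> and environment \<open>env\<close>, the expression \<open>e\<close> evaluates
  to \<open>v\<close> in exactly \<open>t\<close> steps (call by value).\<close>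

inductive eval :: "program \<Rightarrow> tree list \<Rightarrow> exp \<Rightarrow> tree \<Rightarrow> nat \<Rightarrow> bool"
  and evals :: "program \<Rightarrow> tree list \<Rightarrow> exp list \<Rightarrow> tree list \<Rightarrow> nat \<Rightarrow> bool"
  for P :: program where
  eval_Var: "i < length env \<Longrightarrow> eval P env (Var i) (env ! i) 1"
| eval_Empty: "eval P env Empty Leaf 1"
| eval_Cell: "eval P env a u s \<Longrightarrow> eval P env b v t \<Longrightarrow>
    eval P env (Cell a b) (Node u v) (Suc (s + t))"
| eval_Hd: "eval P env a u s \<Longrightarrow> eval P env (Hd a) (hd_tree u) (Suc s)"
| eval_Tl: "eval P env a u s \<Longrightarrow> eval P env (Tl a) (tl_tree u) (Suc s)"
| eval_Ifnode_true: "eval P env c u s \<Longrightarrow> u \<noteq> Leaf \<Longrightarrow> eval P env a v t \<Longrightarrow>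
    eval P env (Ifnode c a b) v (Suc (s + t))"
| eval_Ifnode_false: "eval P env c Leaf s \<Longrightarrow> eval P env b v t \<Longrightarrow>
    eval P env (Ifnode c a b) v (Suc (s + t))"
| eval_Bind: "eval P env a u s \<Longrightarrow> eval P (u # env) b v t \<Longrightarrow>
    eval P env (Bind a b) v (Suc (s + t))"
| eval_Call: "evals P env as us s \<Longrightarrow> f < length P \<Longrightarrow> eval P us (P ! f) v t \<Longrightarrow>
    eval P env (Call f as) v (Suc (s + t))"
| evals_Nil: "evals P env [] [] 0"
| evals_Cons: "eval P env a u s \<Longrightarrow> evals P env as us t \<Longrightarrow>
    evals P env (a # as) (u # us) (s + t)"

inductive_cases eval_elims:
  "eval P env (Var i) v t" "eval P env Empty v t" "eval P env (Cell a b) v t"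
  "eval P env (Hd a) v t" "eval P env (Tl a) v t" "eval P env (Ifnode a b c) v t"
  "eval P env (Bind a b) v t" "eval P env (Call f as) v t"
  "evals P env [] vs t" "evals P env (a # as) vs t"

lemma eval_deterministic:
  "eval P env a v t \<Longrightarrow> eval P env a v' t' \<Longrightarrow> v = v' \<and> t = t'"
  "evals P env as vs t \<Longrightarrow> evals P env as vs' t' \<Longrightarrow> vs = vs' \<and> t = t'"
proof (induction arbitrary: v' t' and vs' t' rule: eval_evals.inducts)
  case (eval_Var i env)
  then show ?case by (auto elim: eval_elims)
next
  case (eval_Empty env)
  then show ?case by (auto elim: eval_elims)
next
  case (eval_Cell env a u s b v t)
  from eval_Cell.prems show ?case
    by (rule eval_elims) (auto dest: eval_Cell.IH(2,4))
next
  case (eval_Hd env a u s)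
  from eval_Hd.prems show ?case
    by (rule eval_elims) (auto dest: eval_Hd.IH(2))
next
  case (eval_Tl env a u s)
  from eval_Tl.prems show ?case
    by (rule eval_elims) (auto dest: eval_Tl.IH(2))
next
  case (eval_Ifnode_true env c u s a v t b)
  from eval_Ifnode_true.prems show ?case
    by (rule eval_elims) (use eval_Ifnode_true.hyps in \<open>auto dest: eval_Ifnode_true.IH(2,4)\<close>)
next
  case (eval_Ifnode_false env c s b v t a)
  from eval_Ifnode_false.prems show ?case
    by (rule eval_elims) (auto dest: eval_Ifnode_false.IH(2,4))
next
  case (eval_Bind env a u s b v t)
  from eval_Bind.prems show ?case
  proof (rule eval_elims)
    fix u' s' t'' assume *: "eval P env a u' s'" "eval P (u' # env) b v' t''" "t' = Suc (s' + t'')"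
    from eval_Bind.IH(2)[OF *(1)] eval_Bind.IH(4) * show ?thesis by auto
  qed
next
  case (eval_Call env as us s f v t)
  from eval_Call.prems show ?case
  proof (rule eval_elims)
    fix us' s' t'' assume *: "evals P env as us' s'" "eval P us' (P ! f) v' t''" "t' = Suc (s' + t'')"
    from eval_Call.IH(2)[OF *(1)] eval_Call.IH(5) * show ?thesis by auto
  qed
next
  case (evals_Nil env)
  then show ?case by (auto elim: eval_elims)
next
  case (evals_Cons env a u s as us t)
  from evals_Cons.prems show ?case
    by (rule eval_elims) (auto dest: evals_Cons.IH(2,4))
qed


section \<open>Encoding of the input\<close>

text \<open>Numbers are written in unary. Since the time bounds are stated in terms of the number of
  vertices, the number of labels and the length of the expression, and not in terms of the size
  of the encoding, this gives an algorithm no additional time.\<close>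

fun enc_nat :: "nat \<Rightarrow> tree" where
  "enc_nat 0 = Leaf"
| "enc_nat (Suc n) = Node Leaf (enc_nat n)"

definition enc_bool :: "bool \<Rightarrow> tree" where
  "enc_bool b = (if b then Node Leaf Leaf else Leaf)"

definition enc_int :: "int \<Rightarrow> tree" where
  "enc_int z = Node (enc_bool (z < 0)) (enc_nat (nat \<bar>z\<bar>))"

fun enc_list :: "tree list \<Rightarrow> tree" where
  "enc_list [] = Leaf"
| "enc_list (x # xs) = Node x (enc_list xs)"

fun enc_cw :: "cw_expr \<Rightarrow> tree" where
  "enc_cw (Create v l) = enc_list [enc_nat 0, enc_nat v, enc_nat l]"
| "enc_cw (Rename l l' e) = enc_list [enc_nat 1, enc_nat l, enc_nat l', enc_cw e]"
| "enc_cw (Join l l' e) = enc_list [enc_nat 2, enc_nat l, enc_nat l', enc_cw e]"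
| "enc_cw (Disj_Union e1 e2) = enc_list [enc_nat 3, enc_cw e1, enc_cw e2]"

text \<open>Adjacency matrix and characteristic vectors of the red and the blue vertices, for graphs
  whose vertices are numbered \<open>0, ..., n - 1\<close>.\<close>

definition enc_graph :: "rbgraph \<Rightarrow> tree" where
  "enc_graph G = (let vs = [0..<card (verts G)] in enc_list
     [enc_list (map (\<lambda>u. enc_list (map (\<lambda>v. enc_bool ({u, v} \<in> edges G)) vs)) vs),
      enc_list (map (\<lambda>v. enc_bool (v \<in> red G)) vs),
      enc_list (map (\<lambda>v. enc_bool (v \<in> blue G)) vs)])"

definition enc_input :: "rbgraph \<Rightarrow> int \<Rightarrow> int \<Rightarrow> cw_expr \<Rightarrow> tree" where
  "enc_input G k \<gamma> e = enc_list [enc_graph G, enc_int k, enc_int \<gamma>, enc_cw e]"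

text \<open>Any value other than \<open>enc_bool True\<close> and \<open>enc_bool False\<close> is not an answer. By determinism,
  there is at most one pair of result and running time.\<close>

definition answers_within :: "program \<Rightarrow> tree \<Rightarrow> bool \<Rightarrow> nat \<Rightarrow> bool" where
  "answers_within P x b T \<longleftrightarrow> P \<noteq> [] \<and> (\<exists>t\<le>T. eval P [x] (P ! 0) (enc_bool b) t)"

end

theory Submission
  imports Defs
begin

text \<open>
  Deleting \<open>S\<close> helps a set \<open>D\<close> of red vertices exactly by removing the blue vertices that \<open>D\<close>
  leaves undominated. So the question is whether some \<open>D\<close> of size at most \<open>\<gamma>\<close> leaves at most \<open>k\<close>
  blue vertices undominated.

  For sets \<open>C\<close> and \<open>F\<close> of labels, consider the generating function
  \<open>\<Sum>\<^sub>D x ^ card D * y ^ u(D)\<close>, where \<open>D\<close> ranges over the red sets that avoid the labels in \<open>C\<close>, and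
  \<open>u(D)\<close> counts the undominated blue vertices whose label is not in \<open>F\<close> (the labels in \<open>F\<close> are promised to
  be dominated later). Since the condition on \<open>C\<close> is avoidance rather than prescription, these
  functions are multiplied pointwise under disjoint union, so no subset convolution is
  needed, and there are \<open>4 ^ cw\<close> of them. A renaming only re-indexes them. A join is the composition
  of two directed joins; \<open>D\<close> either avoids the source label, and then nothing changes, or hits it,
  and then the target label may be added to \<open>F\<close>, which gives a three-term inclusion-exclusion.

  The numbers are kept as bit strings: \<open>x\<close> and \<open>y\<close> are powers of two so large that the coefficients do
  not overlap, and computing modulo a suitable power of two discards the sets of more than \<open>\<gamma>\<close>
  vertices. The tables are indexed by the labels that occur in the expression: their number is
  bounded both by \<open>cw\<close> and linearly in the length of the expression, so that a factor polynomial
  in it is harmless, whereas a factor polynomial in \<open>cw\<close> next to \<open>4 ^ cw\<close> would not be.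
\<close>

section \<open>Evaluation as a partial function\<close>

text \<open>Writing evaluation as a partial function lets \<open>simp\<close> execute programs
  symbolically. By \<open>eval_deterministic\<close> the choice made by \<open>SOME\<close> is
  unique.\<close>

definition run :: "program \<Rightarrow> tree list \<Rightarrow> exp \<Rightarrow> (tree \<times> nat) option" where
  "run P env a = (if \<exists>v t. eval P env a v t then Some (SOME (v, t). eval P env a v t) else None)"

definition runs :: "program \<Rightarrow> tree list \<Rightarrow> exp list \<Rightarrow> (tree list \<times> nat) option" where
  "runs P env as = (if \<exists>vs t. evals P env as vs t then Some (SOME (vs, t). evals P env as vs t) else None)"

text \<open>Symbolic execution stops at this constant. A recursive body is therefore unfolded once,
  by \<open>call_prog\<close>, and its inner calls are rewritten with the induction
  hypotheses.\<close>

definition call :: "program \<Rightarrow> nat \<Rightarrow> tree list \<Rightarrow> (tree \<times> nat) option" where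
  "call P f us = run P us (P ! f)"

lemma run_iff: "run P env a = Some (v, t) \<longleftrightarrow> eval P env a v t"
proof (cases "\<exists>v t. eval P env a v t")
  case True
  then obtain v' t' where *: "eval P env a v' t'" by blast
  have "(SOME (v, t). eval P env a v t) = (v', t')"
    by (rule some_equality) (use * in \<open>auto dest: eval_deterministic(1)\<close>)
  with True have "run P env a = Some (v', t')" by (simp add: run_def)
  then show ?thesis using * eval_deterministic(1)[OF *, of v t] by (cases "eval P env a v t") auto
qed (simp add: run_def)

lemma runs_iff: "runs P env as = Some (vs, t) \<longleftrightarrow> evals P env as vs t"
proof (cases "\<exists>v t. evals P env as v t")
  case True
  then obtain v' t' where *: "evals P env as v' t'" by blast
  have "(SOME (v, t). evals P env as v t) = (v', t')"
    by (rule some_equality) (use * in \<open>auto dest: eval_deterministic(2)\<close>)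
  with True have "runs P env as = Some (v', t')" by (simp add: runs_def)
  then show ?thesis using * eval_deterministic(2)[OF *, of vs t] by (cases "evals P env as vs t") auto
qed (simp add: runs_def)

lemma option_pair_eqI: "(\<And>v t. x = Some (v, t) \<longleftrightarrow> y = Some (v, t)) \<Longrightarrow> x = y"
  by (metis option.exhaust surj_pair)

lemma run_eqI:
  "(\<And>v t. eval P env a v t \<longleftrightarrow> y = Some (v, t)) \<Longrightarrow> run P env a = y"
  by (rule option_pair_eqI) (simp add: run_iff)

lemma runs_eqI:
  "(\<And>vs t. evals P env as vs t \<longleftrightarrow> y = Some (vs, t)) \<Longrightarrow> runs P env as = y"
  by (rule option_pair_eqI) (simp add: runs_iff)

lemma run_simps [simp]:
  "run P env (Var i) = (if i < length env then Some (env ! i, 1) else None)"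
  "run P env Empty = Some (Leaf, 1)"
  "run P env (Cell a b) = Option.bind (run P env a) (\<lambda>(u, s).
     Option.bind (run P env b) (\<lambda>(v, t). Some (Node u v, Suc (s + t))))"
  "run P env (Hd a) = map_option (\<lambda>(u, s). (hd_tree u, Suc s)) (run P env a)"
  "run P env (Tl a) = map_option (\<lambda>(u, s). (tl_tree u, Suc s)) (run P env a)"
  "run P env (Ifnode c a b) = Option.bind (run P env c) (\<lambda>(u, s).
     map_option (\<lambda>(v, t). (v, Suc (s + t))) (if u = Leaf then run P env b else run P env a))"
  "run P env (Bind a b) = Option.bind (run P env a) (\<lambda>(u, s).
     map_option (\<lambda>(v, t). (v, Suc (s + t))) (run P (u # env) b))"
  "run P env (Call f as) = Option.bind (runs P env as) (\<lambda>(us, s).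
     if f < length P then map_option (\<lambda>(v, t). (v, Suc (s + t))) (call P f us) else None)"
  "runs P env [] = Some ([], 0)"
  "runs P env (a # as) = Option.bind (run P env a) (\<lambda>(u, s).
     map_option (\<lambda>(us, t). (u # us, s + t)) (runs P env as))"
proof -
  note simps = run_iff runs_iff call_def Option.bind_eq_Some_conv
  show "run P env (Var i) = (if i < length env then Some (env ! i, 1) else None)"
    by (rule run_eqI) (auto elim: eval_elims intro: eval_Var[unfolded One_nat_def])
  show "run P env Empty = Some (Leaf, 1)"
    by (rule run_eqI) (auto elim: eval_elims intro: eval_Empty[unfolded One_nat_def])
  show "run P env (Cell a b) = Option.bind (run P env a) (\<lambda>(u, s).
     Option.bind (run P env b) (\<lambda>(v, t). Some (Node u v, Suc (s + t))))"
    by (rule run_eqI) (fastforce simp: simps elim: eval_elims intro: eval_Cell)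
  show "run P env (Hd a) = map_option (\<lambda>(u, s). (hd_tree u, Suc s)) (run P env a)"
    by (rule run_eqI) (fastforce simp: simps elim: eval_elims intro: eval_Hd)
  show "run P env (Tl a) = map_option (\<lambda>(u, s). (tl_tree u, Suc s)) (run P env a)"
    by (rule run_eqI) (fastforce simp: simps elim: eval_elims intro: eval_Tl)
  show "run P env (Ifnode c a b) = Option.bind (run P env c) (\<lambda>(u, s).
     map_option (\<lambda>(v, t). (v, Suc (s + t))) (if u = Leaf then run P env b else run P env a))"
  proof (rule run_eqI, rule iffI)
    fix v t assume "eval P env (Ifnode c a b) v t"
    then show "Option.bind (run P env c) (\<lambda>(u, s). map_option (\<lambda>(v, t). (v, Suc (s + t)))
        (if u = Leaf then run P env b else run P env a)) = Some (v, t)"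
      by (rule eval_elims(6)) (simp_all flip: run_iff)
  next
    fix v t
    assume *: "Option.bind (run P env c) (\<lambda>(u, s). map_option (\<lambda>(v, t). (v, Suc (s + t)))
        (if u = Leaf then run P env b else run P env a)) = Some (v, t)"
    then obtain u s where c: "run P env c = Some (u, s)" by (cases "run P env c") auto
    show "eval P env (Ifnode c a b) v t"
      using * c by (cases "u = Leaf") (auto simp: run_iff intro: eval_Ifnode_true eval_Ifnode_false)
  qed
  show "run P env (Bind a b) = Option.bind (run P env a) (\<lambda>(u, s).
     map_option (\<lambda>(v, t). (v, Suc (s + t))) (run P (u # env) b))"
    by (rule run_eqI) (fastforce simp: simps elim: eval_elims(7) intro: eval_Bind)
  show "run P env (Call f as) = Option.bind (runs P env as) (\<lambda>(us, s).
     if f < length P then map_option (\<lambda>(v, t). (v, Suc (s + t))) (call P f us) else None)"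
    by (rule run_eqI) (fastforce simp: simps split: if_splits elim: eval_elims(8) intro: eval_Call)
  show "runs P env [] = Some ([], 0)"
    by (rule runs_eqI) (auto elim: eval_elims intro: evals_Nil)
  show "runs P env (a # as) = Option.bind (run P env a) (\<lambda>(u, s).
     map_option (\<lambda>(us, t). (u # us, s + t)) (runs P env as))"
    by (rule runs_eqI) (fastforce simp: simps elim: eval_elims(10) intro: evals_Cons)
qed

section \<open>The program\<close>

text \<open>Bit strings are written with the least significant bit first.\<close>

definition bits :: "bool list \<Rightarrow> tree" where
  "bits bs = enc_list (map enc_bool bs)"

lemma bits_simps [simp]: "bits [] = Leaf" "bits (b # bs) = Node (enc_bool b) (bits bs)"
  by (simp_all add: bits_def)

lemma enc_nat_eq_bits: "enc_nat n = bits (replicate n False)"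
  by (induction n) (simp_all add: enc_bool_def)

lemma enc_bool_simps [simp]: "enc_bool True = Node Leaf Leaf" "enc_bool False = Leaf"
  by (simp_all add: enc_bool_def)

section \<open>Shorthands for expressions and the bodies of the functions\<close>

fun list_exp :: "exp list \<Rightarrow> exp" where
  "list_exp [] = Empty"
| "list_exp (a # as) = Cell a (list_exp as)"

fun field_exp :: "nat \<Rightarrow> exp \<Rightarrow> exp" where
  "field_exp 0 a = Hd a"
| "field_exp (Suc i) a = field_exp i (Tl a)"

lemma field_exp_numeral [simp]: "field_exp (numeral k) a = field_exp (pred_numeral k) (Tl a)"
  by (simp add: numeral_eq_Suc)

lemma enc_nat_numeral [simp]: "enc_nat (numeral k) = Node Leaf (enc_nat (pred_numeral k))"
  by (simp add: numeral_eq_Suc)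

abbreviation "True_exp \<equiv> Cell Empty Empty"
abbreviation "Not_exp a \<equiv> Ifnode a Empty True_exp"

abbreviation "APPEND a b \<equiv> Call 1 [a, b]"
abbreviation "MULT a b \<equiv> Call 2 [a, b]"
abbreviation "MINIMUM a b \<equiv> Call 3 [a, b]"
abbreviation "EQ a b \<equiv> Call 4 [a, b]"
abbreviation "INSERT labs l \<equiv> Call 5 [labs, l]"
abbreviation "LABELS e labs \<equiv> Call 6 [e, labs]"
abbreviation "INDEX labs l \<equiv> Call 7 [labs, l]"
abbreviation "NTH xs i \<equiv> Call 8 [xs, i]"
abbreviation "UPDATE xs i b \<equiv> Call 9 [xs, i, b]"
abbreviation "ADDER a b c s \<equiv> Call 10 [a, b, c, s]"
abbreviation "MULADD z a b \<equiv> Call 11 [z, a, b]"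
abbreviation "LOOKUP t a f \<equiv> Call 12 [t, a, f]"
abbreviation "ENTRY s a f \<equiv> Call 13 [s, a, f]"
abbreviation "BUILD labs s a f \<equiv> Call 14 [labs, s, a, f]"
abbreviation "TABLE e g \<equiv> Call 15 [e, g]"
abbreviation "ANYSET xs m \<equiv> Call 16 [xs, m]"
abbreviation "DROP xs m \<equiv> Call 17 [xs, m]"
abbreviation "SCAN xs w m q \<equiv> Call 18 [xs, w, m, q]"

text \<open>Only the length of the first list matters: its entries are replaced by zeros. So the
  same function adds unary numbers, writes powers of two in binary, and turns the list of labels
  into an all-zero vector.\<close>

definition append_body :: exp where
  "append_body = Ifnode (Var 0) (Cell Empty (APPEND (Tl (Var 0)) (Var 1))) (Var 1)"

definition mult_body :: exp where
  "mult_body = Ifnode (Var 0) (APPEND (Var 1) (MULT (Tl (Var 0)) (Var 1))) Empty"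

definition min_body :: exp where
  "min_body = Ifnode (Var 0) (Ifnode (Var 1) (Cell Empty (MINIMUM (Tl (Var 0)) (Tl (Var 1)))) Empty) Empty"

definition eq_body :: exp where
  "eq_body = Ifnode (Var 0) (Ifnode (Var 1) (EQ (Tl (Var 0)) (Tl (Var 1))) Empty) (Not_exp (Var 1))"

definition insert_body :: exp where
  "insert_body = Ifnode (Var 0)
     (Ifnode (EQ (Hd (Var 0)) (Var 1)) (Var 0) (Cell (Hd (Var 0)) (INSERT (Tl (Var 0)) (Var 1))))
     (Cell (Var 1) Empty)"

text \<open>The inner test on the unary operation code succeeds for code 3 only, so renaming and
  join share a branch.\<close>

definition labels_body :: exp where
  "labels_body = Ifnode (Hd (Var 0))
     (Ifnode (Tl (Tl (Hd (Var 0))))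
       (LABELS (field_exp 2 (Var 0)) (LABELS (field_exp 1 (Var 0)) (Var 1)))
       (LABELS (field_exp 3 (Var 0)) (INSERT (INSERT (Var 1) (field_exp 1 (Var 0))) (field_exp 2 (Var 0)))))
     (INSERT (Var 1) (field_exp 2 (Var 0)))"

definition index_body :: exp where
  "index_body = Ifnode (Var 0)
     (Ifnode (EQ (Hd (Var 0)) (Var 1)) Empty (Cell Empty (INDEX (Tl (Var 0)) (Var 1)))) Empty"

definition nth_body :: exp where
  "nth_body = Ifnode (Var 1) (NTH (Tl (Var 0)) (Tl (Var 1))) (Hd (Var 0))"

definition update_body :: exp where
  "update_body = Ifnode (Var 1) (Cell (Hd (Var 0)) (UPDATE (Tl (Var 0)) (Tl (Var 1)) (Var 2)))
     (Cell (Var 2) (Tl (Var 0)))"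

text \<open>The bound variable is the current bit of the second number, negated under the flag. The
  recursion follows the first number, so the second is extended by zeros (before negation) or cut
  off.\<close>

definition adder_body :: exp where
  "adder_body = Ifnode (Var 0)
     (Bind (Ifnode (Var 3) (Not_exp (Hd (Var 1))) (Hd (Var 1)))
       (Ifnode (Hd (Var 1))
         (Ifnode (Var 0)
           (Cell (Var 3) (ADDER (Tl (Var 1)) (Tl (Var 2)) True_exp (Var 4)))
           (Cell (Not_exp (Var 3)) (ADDER (Tl (Var 1)) (Tl (Var 2)) (Var 3) (Var 4))))
         (Ifnode (Var 0)
           (Cell (Not_exp (Var 3)) (ADDER (Tl (Var 1)) (Tl (Var 2)) (Var 3) (Var 4)))
           (Cell (Var 3) (ADDER (Tl (Var 1)) (Tl (Var 2)) Empty (Var 4))))))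
     Empty"

definition muladd_body :: exp where
  "muladd_body = Ifnode (Var 1)
     (MULADD (Ifnode (Hd (Var 1)) (ADDER (Var 0) (Var 2) Empty Empty) (Var 0))
       (Tl (Var 1)) (Cell Empty (Var 2)))
     (Var 0)"

definition lookup_body :: exp where
  "lookup_body = Ifnode (Var 1)
     (Bind (LOOKUP (Var 0) (Tl (Var 1)) (Tl (Var 2)))
       (Bind (Ifnode (Hd (Var 2)) (Tl (Var 0)) (Hd (Var 0)))
         (Ifnode (Hd (Var 4)) (Tl (Var 0)) (Hd (Var 0)))))
     (Var 0)"

text \<open>The first argument \<open>s\<close> of \<open>ENTRY\<close> and \<open>BUILD\<close> describes how one table arises from others; its
  first component is the code that \<open>enc_cw\<close> gives to the operation, except that code 2 stands for a
  directed join. The arguments \<open>a\<close> and \<open>f\<close> are the characteristic vectors of \<open>C\<close> and \<open>F\<close>.\<close>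

definition entry_create_body :: exp where
  "entry_create_body = Bind
     (ADDER (field_exp 4 (Var 0))
       (Ifnode (NTH (Var 2) (field_exp 1 (Var 0))) (list_exp [True_exp]) (field_exp 3 (Var 0))) Empty Empty)
     (Ifnode (field_exp 2 (Var 1))
       (Ifnode (NTH (Var 2) (field_exp 1 (Var 1))) (Var 0)
         (ADDER (Var 0) (field_exp 5 (Var 1)) Empty Empty))
       (Var 0))"

definition entry_rename_body :: exp where
  "entry_rename_body = LOOKUP (field_exp 3 (Var 0))
     (UPDATE (Var 1) (field_exp 1 (Var 0)) (NTH (Var 1) (field_exp 2 (Var 0))))
     (UPDATE (Var 2) (field_exp 1 (Var 0)) (NTH (Var 2) (field_exp 2 (Var 0))))"

definition entry_join_body :: exp where
  "entry_join_body = Bind (UPDATE (Var 1) (field_exp 1 (Var 0)) True_exp)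
     (Bind (UPDATE (Var 3) (field_exp 2 (Var 1)) True_exp)
       (ADDER
         (ADDER (LOOKUP (field_exp 3 (Var 2)) (Var 3) (Var 0))
           (LOOKUP (field_exp 3 (Var 2)) (Var 1) (Var 0)) True_exp True_exp)
         (LOOKUP (field_exp 3 (Var 2)) (Var 1) (Var 4)) Empty Empty))"

definition entry_union_body :: exp where
  "entry_union_body = MULADD (field_exp 3 (Var 0))
     (LOOKUP (field_exp 1 (Var 0)) (Var 1) (Var 2)) (LOOKUP (field_exp 2 (Var 0)) (Var 1) (Var 2))"

definition entry_body :: exp where
  "entry_body = Ifnode (Hd (Var 0))
     (Ifnode (Tl (Hd (Var 0)))
       (Ifnode (Tl (Tl (Hd (Var 0)))) entry_union_body entry_join_body)
       entry_rename_body)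
     entry_create_body"

text \<open>The list of labels only supplies the recursion depth. Each level branches into the four
  values of a pair of bits, which is the source of \<open>4 ^ length labs\<close>.\<close>

definition build_body :: exp where
  "build_body = Ifnode (Var 0)
     (Cell
       (Cell (BUILD (Tl (Var 0)) (Var 1) (Cell Empty (Var 2)) (Cell Empty (Var 3)))
         (BUILD (Tl (Var 0)) (Var 1) (Cell Empty (Var 2)) (Cell True_exp (Var 3))))
       (Cell (BUILD (Tl (Var 0)) (Var 1) (Cell True_exp (Var 2)) (Cell Empty (Var 3)))
         (BUILD (Tl (Var 0)) (Var 1) (Cell True_exp (Var 2)) (Cell True_exp (Var 3)))))
     (ENTRY (Var 1) (Var 2) (Var 3))"

definition num_exp :: "nat \<Rightarrow> exp" where
  "num_exp n = list_exp (replicate n Empty)"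

text \<open>The second argument bundles the data common to all tables, in the order fixed by
  \<open>params\<close> below. An undirected join is built as two nested directed joins with the two
  indices exchanged.\<close>

definition table_body :: exp where
  "table_body = Ifnode (Hd (Var 0))
     (Ifnode (Tl (Hd (Var 0)))
       (Ifnode (Tl (Tl (Hd (Var 0))))
         (BUILD (field_exp 0 (Var 1))
           (list_exp [num_exp 3, TABLE (field_exp 1 (Var 0)) (Var 1), TABLE (field_exp 2 (Var 0)) (Var 1),
             field_exp 1 (Var 1)]) Empty Empty)
         (Bind (INDEX (field_exp 0 (Var 1)) (field_exp 1 (Var 0)))
           (Bind (INDEX (field_exp 0 (Var 2)) (field_exp 2 (Var 1)))
             (BUILD (field_exp 0 (Var 3))
               (list_exp [num_exp 2, Var 0, Var 1,
                 BUILD (field_exp 0 (Var 3))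
                   (list_exp [num_exp 2, Var 1, Var 0, TABLE (field_exp 3 (Var 2)) (Var 3)]) Empty Empty])
               Empty Empty))))
       (BUILD (field_exp 0 (Var 1))
         (list_exp [num_exp 1, INDEX (field_exp 0 (Var 1)) (field_exp 1 (Var 0)),
           INDEX (field_exp 0 (Var 1)) (field_exp 2 (Var 0)), TABLE (field_exp 3 (Var 0)) (Var 1)])
         Empty Empty))
     (BUILD (field_exp 0 (Var 1))
       (list_exp [num_exp 0, INDEX (field_exp 0 (Var 1)) (field_exp 2 (Var 0)),
         NTH (field_exp 4 (Var 1)) (field_exp 1 (Var 0)),
         Ifnode (NTH (field_exp 5 (Var 1)) (field_exp 1 (Var 0))) (field_exp 3 (Var 1)) (list_exp [True_exp]),
         field_exp 1 (Var 1), field_exp 2 (Var 1)])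
       Empty Empty)"

definition anyset_body :: exp where
  "anyset_body = Ifnode (Var 1)
     (Ifnode (Var 0) (Ifnode (Hd (Var 0)) True_exp (ANYSET (Tl (Var 0)) (Tl (Var 1)))) Empty) Empty"

definition drop_body :: exp where
  "drop_body = Ifnode (Var 1) (DROP (Tl (Var 0)) (Tl (Var 1))) (Var 0)"

definition scan_body :: exp where
  "scan_body = Ifnode (Var 3)
     (Ifnode (ANYSET (Var 0) (Var 1)) True_exp
       (SCAN (DROP (Var 0) (Var 2)) (Var 1) (Var 2) (Tl (Var 3)))) Empty"

text \<open>Both budgets are cut off at the number of vertices, because \<open>k\<close> may be arbitrarily large while
  the running time may not depend on it.\<close>

definition main_body :: exp where
  "main_body =
     Ifnode (Hd (field_exp 1 (Var 0))) Empty (Ifnode (Hd (field_exp 2 (Var 0))) Empty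
     (Bind (field_exp 0 (Var 0))
     (Bind (APPEND (field_exp 1 (Var 0)) True_exp)
     (Bind (MULT (Var 0) (Var 0))
     (Bind (MINIMUM (Cell Empty (Tl (field_exp 2 (Var 3)))) (Var 1))
     (Bind (MULT (Var 1) (Var 0))
     (Bind (LABELS (field_exp 3 (Var 5)) Empty)
     (Bind (APPEND (Var 0) Empty)
     (SCAN
       (LOOKUP
         (TABLE (field_exp 3 (Var 7))
           (list_exp [Var 1, Var 2, APPEND (Var 4) (list_exp [True_exp]),
             APPEND (Var 5) (list_exp [True_exp]), field_exp 1 (Var 6), field_exp 2 (Var 6)]))
         (Var 0) (Var 0))
       (MULT (Var 5) (MINIMUM (Cell Empty (Tl (field_exp 1 (Var 7)))) (Var 5)))
       (Var 4) (Var 3))))))))))"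

definition prog :: program where
  "prog = [main_body, append_body, mult_body, min_body, eq_body, insert_body, labels_body,
     index_body, nth_body, update_body, adder_body, muladd_body, lookup_body, entry_body,
     build_body, table_body, anyset_body, drop_body, scan_body]"

lemma length_prog [simp]: "length prog = 19"
  by (simp add: prog_def)

text \<open>Index 1 is listed in two forms because \<open>simp\<close> rewrites the literal to
  \<open>Suc 0\<close>.\<close>

lemma call_prog:
  "call prog 0 us = run prog us main_body"
  "call prog 1 us = run prog us append_body"
  "call prog (Suc 0) us = run prog us append_body"
  "call prog 2 us = run prog us mult_body"
  "call prog 3 us = run prog us min_body"
  "call prog 4 us = run prog us eq_body"
  "call prog 5 us = run prog us insert_body"
  "call prog 6 us = run prog us labels_body"
  "call prog 7 us = run prog us index_body"
  "call prog 8 us = run prog us nth_body"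
  "call prog 9 us = run prog us update_body"
  "call prog 10 us = run prog us adder_body"
  "call prog 11 us = run prog us muladd_body"
  "call prog 12 us = run prog us lookup_body"
  "call prog 13 us = run prog us entry_body"
  "call prog 14 us = run prog us build_body"
  "call prog 15 us = run prog us table_body"
  "call prog 16 us = run prog us anyset_body"
  "call prog 17 us = run prog us drop_body"
  "call prog 18 us = run prog us scan_body"
  by (simp_all add: call_def prog_def)

section \<open>Function calls with bounded running time\<close>

definition computes :: "nat \<Rightarrow> tree list \<Rightarrow> tree \<Rightarrow> nat \<Rightarrow> bool" where
  "computes f us v T \<longleftrightarrow> (\<exists>t\<le>T. call prog f us = Some (v, t))"

lemma computesE:
  assumes "computes f us v T"
  obtains t where "t \<le> T" "call prog f us = Some (v, t)"
  using assms by (auto simp: computes_def)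

lemma computes_mono: "computes f us v T \<Longrightarrow> T \<le> T' \<Longrightarrow> computes f us v T'"
  by (auto simp: computes_def intro: order_trans)

lemma computes_append:
  "computes 1 [enc_list xs, bits ys] (bits (replicate (length xs) False @ ys)) (10 * length xs + 10)"
proof (induction xs)
  case Nil
  show ?case by (simp add: computes_def call_prog append_body_def)
next
  case (Cons x xs)
  then obtain t where "t \<le> 10 * length xs + 10"
    "call prog 1 [enc_list xs, bits ys] = Some (bits (replicate (length xs) False @ ys), t)"
    by (rule computesE)
  then show ?case unfolding computes_def
    by (subst call_prog) (simp add: append_body_def)
qed

section \<open>Unary arithmetic and lists of labels\<close>

lemma computes_append_nat: "computes 1 [enc_nat m, enc_nat n] (enc_nat (m + n)) (10 * m + 10)"
  using computes_append[of "map enc_bool (replicate m False)" "replicate n False"]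
  by (simp add: enc_nat_eq_bits bits_def replicate_add del: enc_nat.simps)

lemma computes_mult: "computes 2 [enc_nat m, enc_nat n] (enc_nat (m * n)) ((m + 1) * (10 * n + 30))"
proof (induction m)
  case 0
  show ?case by (simp add: computes_def call_prog mult_body_def)
next
  case (Suc m)
  then obtain t where "t \<le> (m + 1) * (10 * n + 30)"
    "call prog 2 [enc_nat m, enc_nat n] = Some (enc_nat (m * n), t)"
    by (rule computesE)
  moreover obtain s where "s \<le> 10 * n + 10"
    "call prog (Suc 0) [enc_nat n, enc_nat (m * n)] = Some (enc_nat (n + m * n), s)"
    using computes_append_nat[of n "m * n"] by (auto elim: computesE)
  ultimately show ?case unfolding computes_def
    by (subst call_prog) (simp add: mult_body_def)
qed

text \<open>Both arguments are consumed in parallel, so the bound depends on the second one only.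
  Hence a budget of any size can be cut off in time depending on the number of vertices.\<close>

lemma computes_min: "computes 3 [enc_nat m, enc_nat n] (enc_nat (min m n)) (20 * n + 20)"
proof (induction n arbitrary: m)
  case 0
  show ?case by (cases m) (simp_all add: computes_def call_prog min_body_def)
next
  case (Suc n)
  show ?case
  proof (cases m)
    case 0
    then show ?thesis by (simp add: computes_def call_prog min_body_def)
  next
    case (Suc m')
    obtain t where "t \<le> 20 * n + 20"
      "call prog 3 [enc_nat m', enc_nat n] = Some (enc_nat (min m' n), t)"
      using Suc.IH by (rule computesE)
    then show ?thesis unfolding computes_def Suc
      by (subst call_prog) (simp add: min_body_def)
  qed
qed

lemma computes_eq: "computes 4 [enc_nat m, enc_nat n] (enc_bool (m = n)) (20 * n + 20)"
proof (induction n arbitrary: m)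
  case 0
  show ?case by (cases m) (simp_all add: computes_def call_prog eq_body_def)
next
  case (Suc n)
  show ?case
  proof (cases m)
    case 0
    then show ?thesis by (simp add: computes_def call_prog eq_body_def)
  next
    case (Suc m')
    obtain t where "t \<le> 20 * n + 20"
      "call prog 4 [enc_nat m', enc_nat n] = Some (enc_bool (m' = n), t)"
      using Suc.IH by (rule computesE)
    then show ?thesis unfolding computes_def Suc
      by (subst call_prog) (simp add: eq_body_def)
  qed
qed

section \<open>Collecting the labels of an expression\<close>

definition enc_labels :: "nat list \<Rightarrow> tree" where
  "enc_labels labs = enc_list (map enc_nat labs)"

lemma enc_labels_simps [simp]:
  "enc_labels [] = Leaf" "enc_labels (l # labs) = Node (enc_nat l) (enc_labels labs)"
  by (simp_all add: enc_labels_def)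

fun insert_label :: "nat list \<Rightarrow> nat \<Rightarrow> nat list" where
  "insert_label [] l = [l]"
| "insert_label (x # labs) l = (if x = l then x # labs else x # insert_label labs l)"

lemma computes_insert:
  "computes 5 [enc_labels labs, enc_nat l] (enc_labels (insert_label labs l))
     ((length labs + 1) * (20 * l + 60))"
proof (induction labs)
  case Nil
  show ?case by (simp add: computes_def call_prog insert_body_def)
next
  case (Cons x labs)
  obtain t where t: "t \<le> (length labs + 1) * (20 * l + 60)"
    "call prog 5 [enc_labels labs, enc_nat l] = Some (enc_labels (insert_label labs l), t)"
    using Cons.IH by (rule computesE)
  obtain s where s: "s \<le> 20 * l + 20" "call prog 4 [enc_nat x, enc_nat l] = Some (enc_bool (x = l), s)"
    using computes_eq by (rule computesE)
  show ?case using s t unfolding computes_def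
    by (subst call_prog) (cases "x = l"; simp add: insert_body_def)
qed

fun collect_labels :: "cw_expr \<Rightarrow> nat list \<Rightarrow> nat list" where
  "collect_labels (Create v l) labs = insert_label labs l"
| "collect_labels (Rename l l' e) labs = collect_labels e (insert_label (insert_label labs l) l')"
| "collect_labels (Join l l' e) labs = collect_labels e (insert_label (insert_label labs l) l')"
| "collect_labels (Disj_Union e1 e2) labs = collect_labels e2 (collect_labels e1 labs)"

lemma set_insert_label [simp]: "set (insert_label labs l) = insert l (set labs)"
  by (induction labs) auto

lemma distinct_insert_label [simp]: "distinct labs \<Longrightarrow> distinct (insert_label labs l)"
  by (induction labs) auto

lemma length_insert_label: "length (insert_label labs l) \<le> Suc (length labs)"
  by (induction labs) auto

fun expr_labels :: "cw_expr \<Rightarrow> nat set" where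
  "expr_labels (Create v l) = {l}"
| "expr_labels (Rename l l' e) = {l, l'} \<union> expr_labels e"
| "expr_labels (Join l l' e) = {l, l'} \<union> expr_labels e"
| "expr_labels (Disj_Union e1 e2) = expr_labels e1 \<union> expr_labels e2"

lemma set_collect_labels: "set (collect_labels e labs) = set labs \<union> expr_labels e"
  by (induction e arbitrary: labs) auto

lemma expr_labels_bounded: "cw_wf cw e \<Longrightarrow> expr_labels e \<subseteq> {1..cw}"
  by (induction e) auto

lemma distinct_collect_labels: "distinct labs \<Longrightarrow> distinct (collect_labels e labs)"
  by (induction e arbitrary: labs) auto

text \<open>Each operation mentions at most two labels. This bound serves for the polynomial factors
  that multiply \<open>4 ^ cw\<close>.\<close>

lemma length_collect_labels: "length (collect_labels e labs) \<le> length labs + 2 * cw_length e"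
proof (induction e arbitrary: labs)
  case (Create v l)
  show ?case using length_insert_label[of labs l] by simp
next
  case (Rename l l' e)
  show ?case using Rename[of "insert_label (insert_label labs l) l'"]
      length_insert_label[of labs l] length_insert_label[of "insert_label labs l" l'] by simp
next
  case (Join l l' e)
  show ?case using Join[of "insert_label (insert_label labs l) l'"]
      length_insert_label[of labs l] length_insert_label[of "insert_label labs l" l'] by simp
next
  case (Disj_Union e1 e2)
  show ?case using Disj_Union(1)[of labs] Disj_Union(2)[of "collect_labels e1 labs"] by simp
qed

lemma length_labels_le: "distinct labs \<Longrightarrow> set labs \<subseteq> {1..cw} \<Longrightarrow> length labs \<le> cw"
  using card_mono[of "{1..cw}" "set labs"] by (simp add: distinct_card)

lemma computes_insert_bounded:
  assumes "distinct labs" "set labs \<subseteq> {1..cw}" "l \<le> cw"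
  shows "computes 5 [enc_labels labs, enc_nat l] (enc_labels (insert_label labs l))
     ((cw + 1) * (20 * cw + 60))"
proof (rule computes_mono[OF computes_insert])
  show "(length labs + 1) * (20 * l + 60) \<le> (cw + 1) * (20 * cw + 60)"
    using assms length_labels_le[of labs cw] by (intro mult_mono) auto
qed

text \<open>An operation costs at most two insertions and some constant overhead, all covered by
  \<open>Q\<close>. Keeping the insertion cost \<open>I\<close> abstract makes the arithmetic of the
  induction linear.\<close>

lemma computes_labels:
  assumes I: "\<And>labs l. distinct labs \<Longrightarrow> set labs \<subseteq> {1..cw} \<Longrightarrow> l \<le> cw \<Longrightarrow>
      computes 5 [enc_labels labs, enc_nat l] (enc_labels (insert_label labs l)) I"
    and Q: "2 * I + 50 \<le> Q"
    and "cw_wf cw e" "distinct labs" "set labs \<subseteq> {1..cw}"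
  shows "computes 6 [enc_cw e, enc_labels labs] (enc_labels (collect_labels e labs)) (cw_length e * Q)"
  using assms(3-)
proof (induction e arbitrary: labs)
  case (Create v l)
  obtain s where "s \<le> I"
    "call prog 5 [enc_labels labs, enc_nat l] = Some (enc_labels (insert_label labs l), s)"
    using Create I[of labs l] by (auto elim: computesE)
  then show ?case using Q unfolding computes_def
    by (subst call_prog) (simp add: labels_body_def)
next
  case (Rename l l' e)
  obtain s where s: "s \<le> I"
    "call prog 5 [enc_labels labs, enc_nat l] = Some (enc_labels (insert_label labs l), s)"
    using Rename.prems I[of labs l] by (auto elim: computesE)
  obtain s' where s': "s' \<le> I"
    "call prog 5 [enc_labels (insert_label labs l), enc_nat l'] =
      Some (enc_labels (insert_label (insert_label labs l) l'), s')"
    using Rename.prems I[of "insert_label labs l" l'] by (auto elim: computesE)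
  obtain t where "t \<le> cw_length e * Q"
    "call prog 6 [enc_cw e, enc_labels (insert_label (insert_label labs l) l')] =
       Some (enc_labels (collect_labels e (insert_label (insert_label labs l) l')), t)"
    using Rename.IH[of "insert_label (insert_label labs l) l'"] Rename.prems by (auto elim: computesE)
  with s s' Q show ?case unfolding computes_def
    by (subst call_prog) (simp add: labels_body_def)
next
  case (Join l l' e)
  obtain s where s: "s \<le> I"
    "call prog 5 [enc_labels labs, enc_nat l] = Some (enc_labels (insert_label labs l), s)"
    using Join.prems I[of labs l] by (auto elim: computesE)
  obtain s' where s': "s' \<le> I"
    "call prog 5 [enc_labels (insert_label labs l), enc_nat l'] =
      Some (enc_labels (insert_label (insert_label labs l) l'), s')"
    using Join.prems I[of "insert_label labs l" l'] by (auto elim: computesE)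
  obtain t where "t \<le> cw_length e * Q"
    "call prog 6 [enc_cw e, enc_labels (insert_label (insert_label labs l) l')] =
       Some (enc_labels (collect_labels e (insert_label (insert_label labs l) l')), t)"
    using Join.IH[of "insert_label (insert_label labs l) l'"] Join.prems by (auto elim: computesE)
  with s s' Q show ?case unfolding computes_def
    by (subst call_prog) (simp add: labels_body_def)
next
  case (Disj_Union e1 e2)
  have wf: "cw_wf cw e1" "cw_wf cw e2" using Disj_Union.prems by auto
  obtain s where s: "s \<le> cw_length e1 * Q"
    "call prog 6 [enc_cw e1, enc_labels labs] = Some (enc_labels (collect_labels e1 labs), s)"
    using Disj_Union.IH(1)[OF wf(1) Disj_Union.prems(2,3)] by (rule computesE)
  have "set (collect_labels e1 labs) \<subseteq> {1..cw}"
    using Disj_Union.prems(3) expr_labels_bounded[OF wf(1)] by (simp add: set_collect_labels)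
  from Disj_Union.IH(2)[OF wf(2) distinct_collect_labels[OF Disj_Union.prems(2)] this]
  obtain t where t: "t \<le> cw_length e2 * Q"
    "call prog 6 [enc_cw e2, enc_labels (collect_labels e1 labs)] =
       Some (enc_labels (collect_labels e2 (collect_labels e1 labs)), t)"
    by (rule computesE)
  from s t Q show ?case unfolding computes_def
    by (subst call_prog) (simp add: labels_body_def add_mult_distrib)
qed

section \<open>Binary arithmetic and tables\<close>

fun index_of :: "nat list \<Rightarrow> nat \<Rightarrow> nat" where
  "index_of [] l = 0"
| "index_of (x # labs) l = (if x = l then 0 else Suc (index_of labs l))"

lemma index_of_less: "l \<in> set labs \<Longrightarrow> index_of labs l < length labs"
  by (induction labs) auto

lemma nth_index_of: "l \<in> set labs \<Longrightarrow> labs ! index_of labs l = l"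
  by (induction labs) auto

lemma computes_index:
  "computes 7 [enc_labels labs, enc_nat l] (enc_nat (index_of labs l))
     ((length labs + 1) * (20 * l + 60))"
proof (induction labs)
  case Nil
  show ?case by (simp add: computes_def call_prog index_body_def)
next
  case (Cons x labs)
  obtain t where t: "t \<le> (length labs + 1) * (20 * l + 60)"
    "call prog 7 [enc_labels labs, enc_nat l] = Some (enc_nat (index_of labs l), t)"
    using Cons.IH by (rule computesE)
  obtain s where s: "s \<le> 20 * l + 20" "call prog 4 [enc_nat x, enc_nat l] = Some (enc_bool (x = l), s)"
    using computes_eq by (rule computesE)
  show ?case using s t unfolding computes_def
    by (subst call_prog) (cases "x = l"; simp add: index_body_def)
qed

lemma computes_nth:
  "i < length bs \<Longrightarrow> computes 8 [bits bs, enc_nat i] (enc_bool (bs ! i)) (20 * i + 20)"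
proof (induction i arbitrary: bs)
  case 0
  then show ?case by (cases bs) (simp_all add: computes_def call_prog nth_body_def)
next
  case (Suc i)
  then obtain b bs' where bs: "bs = b # bs'" "i < length bs'" by (cases bs) auto
  obtain t where "t \<le> 20 * i + 20" "call prog 8 [bits bs', enc_nat i] = Some (enc_bool (bs' ! i), t)"
    using Suc.IH[OF bs(2)] by (rule computesE)
  then show ?case unfolding computes_def bs
    by (subst call_prog) (simp add: nth_body_def)
qed

lemma computes_update:
  "i < length bs \<Longrightarrow>
    computes 9 [bits bs, enc_nat i, enc_bool b] (bits (bs[i := b])) (20 * i + 20)"
proof (induction i arbitrary: bs)
  case 0
  then show ?case by (cases bs) (simp_all add: computes_def call_prog update_body_def)
next
  case (Suc i)
  then obtain c bs' where bs: "bs = c # bs'" "i < length bs'" by (cases bs) auto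
  obtain t where "t \<le> 20 * i + 20"
    "call prog 9 [bits bs', enc_nat i, enc_bool b] = Some (bits (bs'[i := b]), t)"
    using Suc.IH[OF bs(2)] by (rule computesE)
  then show ?case unfolding computes_def bs
    by (subst call_prog) (simp add: update_body_def)
qed

section \<open>Binary addition, subtraction and multiplication\<close>

fun adder :: "bool list \<Rightarrow> bool list \<Rightarrow> bool \<Rightarrow> bool \<Rightarrow> bool list" where
  "adder [] ys c s = []"
| "adder (x # xs) ys c s = (let y = (if ys = [] then False else hd ys) \<noteq> s in
     (x \<noteq> (y \<noteq> c)) # adder xs (tl ys) (if x = y then x else c) s)"

lemma hd_tree_bits: "hd_tree (bits ys) = enc_bool (if ys = [] then False else hd ys)"
  by (cases ys) simp_all

lemma tl_tree_bits: "tl_tree (bits ys) = bits (tl ys)"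
  by (cases ys) simp_all

lemma length_adder [simp]: "length (adder xs ys c s) = length xs"
  by (induction xs arbitrary: ys c) (simp_all add: Let_def)

lemma computes_adder:
  "computes 10 [bits xs, bits ys, enc_bool c, enc_bool s] (bits (adder xs ys c s)) (40 * length xs + 40)"
proof (induction xs arbitrary: ys c)
  case Nil
  show ?case by (simp add: computes_def call_prog adder_body_def)
next
  case (Cons x xs)
  define y where "y = (if ys = [] then False else hd ys)"
  obtain t where t: "t \<le> 40 * length xs + 40"
    "call prog 10 [bits xs, bits (tl ys), enc_bool (if x = (y \<noteq> s) then x else c), enc_bool s] =
      Some (bits (adder xs (tl ys) (if x = (y \<noteq> s) then x else c) s), t)"
    using Cons.IH by (rule computesE)
  show ?case using t unfolding computes_def
    by (subst call_prog)
      (cases x; cases y; cases c; cases s;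
        simp add: adder_body_def hd_tree_bits tl_tree_bits Let_def flip: y_def)
qed

text \<open>Shift-and-add multiplication with accumulator \<open>z\<close>. Since
  \<open>adder\<close> keeps the length of its first argument, the result is automatically reduced
  modulo \<open>2 ^ length z\<close>.\<close>

fun muladd :: "bool list \<Rightarrow> bool list \<Rightarrow> bool list \<Rightarrow> bool list" where
  "muladd z [] b = z"
| "muladd z (x # a) b = muladd (if x then adder z b False False else z) a (False # b)"

lemma length_muladd [simp]: "length (muladd z a b) = length z"
  by (induction z a b rule: muladd.induct) simp_all

lemma computes_muladd:
  "computes 11 [bits z, bits a, bits b] (bits (muladd z a b)) ((length a + 1) * (40 * length z + 80))"
proof (induction z a b rule: muladd.induct)
  case (1 z b)
  show ?case by (simp add: computes_def call_prog muladd_body_def)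
next
  case (2 z x a b)
  let ?z = "if x then adder z b False False else z"
  obtain t where t: "t \<le> (length a + 1) * (40 * length z + 80)"
    "call prog 11 [bits ?z, bits a, bits (False # b)] = Some (bits (muladd ?z a (False # b)), t)"
    using 2 by (auto elim!: computesE[of 11] split: if_splits)
  obtain s where s: "s \<le> 40 * length z + 40"
    "call prog 10 [bits z, bits b, Leaf, Leaf] = Some (bits (adder z b False False), s)"
    using computes_adder[of z b False False] by (auto elim: computesE)
  show ?case using s t unfolding computes_def
    by (subst call_prog) (cases x; simp add: muladd_body_def)
qed

section \<open>Tables stored as quaternary trees\<close>

definition child :: "tree \<Rightarrow> bool \<Rightarrow> bool \<Rightarrow> tree" where
  "child t x y = (let u = (if x then tl_tree t else hd_tree t) in if y then tl_tree u else hd_tree u)"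

text \<open>The last components of the vectors select at the root, because \<open>BUILD\<close>
  prepends the bits chosen at deeper levels.\<close>

fun lookup :: "tree \<Rightarrow> bool list \<Rightarrow> bool list \<Rightarrow> tree" where
  "lookup t [] f = t"
| "lookup t (x # a) f = child (lookup t a (tl f)) x (hd f)"

lemma computes_lookup:
  "length f = length a \<Longrightarrow>
    computes 12 [t, bits a, bits f] (lookup t a f) (40 * length a + 40)"
proof (induction a arbitrary: f)
  case Nil
  then show ?case by (simp add: computes_def call_prog lookup_body_def)
next
  case (Cons x a)
  then obtain y f' where f: "f = y # f'" "length f' = length a" by (cases f) auto
  obtain s where "s \<le> 40 * length a + 40" "call prog 12 [t, bits a, bits f'] = Some (lookup t a f', s)"
    using Cons.IH[OF f(2)] by (rule computesE)
  then show ?case unfolding computes_def f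
    by (subst call_prog) (cases x; cases y; simp add: lookup_body_def child_def Let_def)
qed

type_synonym table = "bool list \<Rightarrow> bool list \<Rightarrow> bool list"

text \<open>The arguments \<open>a\<close> and \<open>f\<close> are the suffixes fixed on the path
  from the root; \<open>n\<close> components in front of them are still open. Two nested pairs
  encode one four-way branching.\<close>

fun enc_table :: "table \<Rightarrow> nat \<Rightarrow> bool list \<Rightarrow> bool list \<Rightarrow> tree" where
  "enc_table T 0 a f = bits (T a f)"
| "enc_table T (Suc n) a f = Node
     (Node (enc_table T n (False # a) (False # f)) (enc_table T n (False # a) (True # f)))
     (Node (enc_table T n (True # a) (False # f)) (enc_table T n (True # a) (True # f)))"

text \<open>The recursion of \<open>lookup\<close> peels vectors at the front, whereas the tree is
  entered with their last components. This rule mediates between the two and drives the reverse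
  induction in \<open>lookup_enc_table\<close>.\<close>

lemma lookup_snoc:
  "length f = length a \<Longrightarrow> lookup t (a @ [x]) (f @ [y]) = lookup (child t x y) a f"
proof (induction a arbitrary: f)
  case (Cons z a)
  then show ?case by (cases f) auto
qed simp

lemma lookup_enc_table:
  "length f = length a \<Longrightarrow> lookup (enc_table T (length a) a' f') a f = bits (T (a @ a') (f @ f'))"
proof (induction a arbitrary: f a' f' rule: rev_induct)
  case (snoc x a)
  then obtain g y where f: "f = g @ [y]" by (cases f rule: rev_cases) auto
  with snoc.prems have len: "length g = length a" by simp
  have "child (enc_table T (Suc (length a)) a' f') x y = enc_table T (length a) (x # a') (y # f')"
    by (cases x; cases y) (simp_all add: child_def)
  with snoc.IH[OF len] show ?case unfolding f by (simp add: lookup_snoc len)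
qed simp

lemma computes_lookup_table:
  "length a = n \<Longrightarrow> length f = n \<Longrightarrow>
    computes 12 [enc_table T n [] [], bits a, bits f] (bits (T a f)) (40 * n + 40)"
  using computes_lookup[of f a "enc_table T n [] []"] lookup_enc_table[of f a T "[]" "[]"] by simp

text \<open>The slack of 50 strengthens the induction: four subtrees leave a slack of 200, which
  pays for the overhead of the inner node and restores the slack of 50.\<close>

lemma computes_build:
  assumes "\<And>a f. length a = n \<Longrightarrow> length f = n \<Longrightarrow> computes 13 [s, bits a, bits f] (bits (T a f)) E"
    and "length labs + length a = n" "length f = length a"
  shows "\<exists>t. t + 50 \<le> 4 ^ length labs * (E + 100) \<and>
    call prog 14 [enc_labels labs, s, bits a, bits f] = Some (enc_table T (length labs) a f, t)"
  using assms(2,3)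
proof (induction labs arbitrary: a f)
  case Nil
  obtain t where "t \<le> E" "call prog 13 [s, bits a, bits f] = Some (bits (T a f), t)"
    using assms(1)[of a f] Nil by (auto elim: computesE)
  then show ?case by (subst call_prog) (simp add: build_body_def)
next
  case (Cons l labs)
  let ?B = "4 ^ length labs * (E + 100)"
  have IH: "\<exists>t. t + 50 \<le> ?B \<and>
    call prog 14 [enc_labels labs, s, Node (enc_bool x) (bits a), Node (enc_bool y) (bits f)] =
      Some (enc_table T (length labs) (x # a) (y # f), t)" for x y
    using Cons.IH[of "x # a" "y # f"] Cons.prems by simp
  obtain t1 where t1: "t1 + 50 \<le> ?B"
    "call prog 14 [enc_labels labs, s, Node Leaf (bits a), Node Leaf (bits f)] =
      Some (enc_table T (length labs) (False # a) (False # f), t1)"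
    using IH[of False False] by auto
  obtain t2 where t2: "t2 + 50 \<le> ?B"
    "call prog 14 [enc_labels labs, s, Node Leaf (bits a), Node (Node Leaf Leaf) (bits f)] =
      Some (enc_table T (length labs) (False # a) (True # f), t2)"
    using IH[of False True] by auto
  obtain t3 where t3: "t3 + 50 \<le> ?B"
    "call prog 14 [enc_labels labs, s, Node (Node Leaf Leaf) (bits a), Node Leaf (bits f)] =
      Some (enc_table T (length labs) (True # a) (False # f), t3)"
    using IH[of True False] by auto
  obtain t4 where t4: "t4 + 50 \<le> ?B"
    "call prog 14 [enc_labels labs, s, Node (Node Leaf Leaf) (bits a), Node (Node Leaf Leaf) (bits f)] =
      Some (enc_table T (length labs) (True # a) (True # f), t4)"
    using IH[of True True] by auto
  show ?case using t1(1) t2(1) t3(1) t4(1)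
    by (subst call_prog) (simp add: build_body_def t1(2) t2(2) t3(2) t4(2) algebra_simps)
qed

lemma computes_build_table:
  assumes "\<And>a f. length a = length labs \<Longrightarrow> length f = length labs \<Longrightarrow>
    computes 13 [s, bits a, bits f] (bits (T a f)) E"
  shows "computes 14 [enc_labels labs, s, Leaf, Leaf] (enc_table T (length labs) [] [])
    (4 ^ length labs * (E + 100))"
  using computes_build[OF assms, where labs = labs and a = "[]" and f = "[]"]
  by (auto simp: computes_def)

section \<open>The entries of the table for each operation\<close>

definition create_entry :: "nat \<Rightarrow> bool list \<Rightarrow> nat \<Rightarrow> bool \<Rightarrow> bool list \<Rightarrow> table" where
  "create_entry M X i r y a f =
     (let z = adder (replicate M False) (if f ! i then [True] else y) False False
      in if r \<and> \<not> a ! i then adder z X False False else z)"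

text \<open>A vertex labelled \<open>l\<close> before the renaming carries \<open>l'\<close>
  afterwards, so the bit of \<open>l\<close> is overwritten by that of \<open>l'\<close> and a
  single old entry is read.\<close>

definition rename_entry :: "nat \<Rightarrow> nat \<Rightarrow> table \<Rightarrow> table" where
  "rename_entry i j T a f = T (a[i := a ! j]) (f[i := f ! j])"

text \<open>The inner \<open>adder\<close> has flag and carry set and thus subtracts. The result is
  the alternating sum of the three terms in \<open>gf_join\<close>.\<close>

definition join_entry :: "nat \<Rightarrow> nat \<Rightarrow> table \<Rightarrow> table" where
  "join_entry i j T a f = adder
     (adder (T a (f[j := True])) (T (a[i := True]) (f[j := True])) True True)
     (T (a[i := True]) f) False False"

text \<open>Starting from a zero string of length \<open>M\<close> fixes the length of the product.
  In \<open>create_entry\<close> the same device pads or truncates a summand to \<open>M\<close>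
  bits.\<close>

definition union_entry :: "nat \<Rightarrow> table \<Rightarrow> table \<Rightarrow> table" where
  "union_entry M T T' a f = muladd (replicate M False) (T a f) (T' a f)"

lemma computes_create_entry:
  assumes "length a = n" "length f = n" "i < n" "100 * (n + M + 3) \<le> E"
  shows "computes 13
    [enc_list [enc_nat 0, enc_nat i, enc_bool r, bits y, enc_nat M, bits X], bits a, bits f]
    (bits (create_entry M X i r y a f)) E"
proof -
  let ?y = "if f ! i then [True] else y"
  let ?z = "adder (replicate M False) ?y False False"
  obtain t1 where t1: "t1 \<le> 20 * i + 20" "call prog 8 [bits f, enc_nat i] = Some (enc_bool (f ! i), t1)"
    using computes_nth[of i f] assms by (auto elim: computesE)
  obtain t2 where t2: "t2 \<le> 40 * M + 40"
    "call prog 10 [enc_nat M, bits ?y, Leaf, Leaf] = Some (bits ?z, t2)"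
    using computes_adder[of "replicate M False" ?y False False]
    by (auto simp flip: enc_nat_eq_bits elim!: computesE[of 10] split: if_splits)
  obtain t3 where t3: "t3 \<le> 20 * i + 20" "call prog 8 [bits a, enc_nat i] = Some (enc_bool (a ! i), t3)"
    using computes_nth[of i a] assms by (auto elim: computesE)
  obtain t4 where t4: "t4 \<le> 40 * M + 40"
    "call prog 10 [bits ?z, bits X, Leaf, Leaf] = Some (bits (adder ?z X False False), t4)"
    using computes_adder[of ?z X False False]
    by (auto elim!: computesE[of 10] split: if_splits)
  show ?thesis
    using t1 t2 t3 t4 assms unfolding computes_def
    by (subst call_prog)
      (cases "f ! i"; cases "a ! i"; cases r;
        simp add: entry_body_def entry_create_body_def create_entry_def Let_def)
qed

lemma computes_rename_entry:
  assumes "length a = n" "length f = n" "i < n" "j < n" "200 * (n + 3) \<le> E"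
  shows "computes 13
    [enc_list [enc_nat 1, enc_nat i, enc_nat j, enc_table T n [] []], bits a, bits f]
    (bits (rename_entry i j T a f)) E"
proof -
  obtain t1 where t1: "t1 \<le> 20 * j + 20" "call prog 8 [bits a, enc_nat j] = Some (enc_bool (a ! j), t1)"
    using computes_nth[of j a] assms by (auto elim: computesE)
  obtain t2 where t2: "t2 \<le> 20 * j + 20" "call prog 8 [bits f, enc_nat j] = Some (enc_bool (f ! j), t2)"
    using computes_nth[of j f] assms by (auto elim: computesE)
  obtain t3 where t3: "t3 \<le> 20 * i + 20"
    "call prog 9 [bits a, enc_nat i, enc_bool (a ! j)] = Some (bits (a[i := a ! j]), t3)"
    using computes_update[of i a "a ! j"] assms by (auto elim: computesE)
  obtain t4 where t4: "t4 \<le> 20 * i + 20"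
    "call prog 9 [bits f, enc_nat i, enc_bool (f ! j)] = Some (bits (f[i := f ! j]), t4)"
    using computes_update[of i f "f ! j"] assms by (auto elim: computesE)
  obtain t5 where t5: "t5 \<le> 40 * n + 40"
    "call prog 12 [enc_table T n [] [], bits (a[i := a ! j]), bits (f[i := f ! j])] =
      Some (bits (T (a[i := a ! j]) (f[i := f ! j])), t5)"
    using computes_lookup_table[of "a[i := a ! j]" n "f[i := f ! j]" T] assms by (auto elim: computesE)
  show ?thesis
    using t1 t2 t3 t4 t5 assms unfolding computes_def
    by (subst call_prog) (simp add: entry_body_def entry_rename_body_def rename_entry_def)
qed

lemma computes_join_entry:
  assumes len: "length a = n" "length f = n" "i < n" "j < n"
    and M: "\<And>a f. length (T a f) = M" and E: "300 * (n + M + 3) \<le> E"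
  shows "computes 13
    [enc_list [enc_nat 2, enc_nat i, enc_nat j, enc_table T n [] []], bits a, bits f]
    (bits (join_entry i j T a f)) E"
proof -
  let ?a = "a[i := True]" and ?f = "f[j := True]"
  let ?d = "adder (T a ?f) (T ?a ?f) True True"
  obtain t1 where t1: "t1 \<le> 20 * i + 20"
    "call prog 9 [bits a, enc_nat i, Node Leaf Leaf] = Some (bits ?a, t1)"
    using computes_update[of i a True] len by (auto elim: computesE)
  obtain t2 where t2: "t2 \<le> 20 * j + 20"
    "call prog 9 [bits f, enc_nat j, Node Leaf Leaf] = Some (bits ?f, t2)"
    using computes_update[of j f True] len by (auto elim: computesE)
  obtain t3 where t3: "t3 \<le> 40 * n + 40"
    "call prog 12 [enc_table T n [] [], bits a, bits ?f] = Some (bits (T a ?f), t3)"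
    using computes_lookup_table[of a n ?f T] len by (auto elim: computesE)
  obtain t4 where t4: "t4 \<le> 40 * n + 40"
    "call prog 12 [enc_table T n [] [], bits ?a, bits ?f] = Some (bits (T ?a ?f), t4)"
    using computes_lookup_table[of ?a n ?f T] len by (auto elim: computesE)
  obtain t5 where t5: "t5 \<le> 40 * n + 40"
    "call prog 12 [enc_table T n [] [], bits ?a, bits f] = Some (bits (T ?a f), t5)"
    using computes_lookup_table[of ?a n f T] len by (auto elim: computesE)
  obtain t6 where t6: "t6 \<le> 40 * M + 40"
    "call prog 10 [bits (T a ?f), bits (T ?a ?f), Node Leaf Leaf, Node Leaf Leaf] = Some (bits ?d, t6)"
    using computes_adder[of "T a ?f" "T ?a ?f" True True] M by (auto elim: computesE)
  obtain t7 where t7: "t7 \<le> 40 * M + 40"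
    "call prog 10 [bits ?d, bits (T ?a f), Leaf, Leaf] = Some (bits (adder ?d (T ?a f) False False), t7)"
    using computes_adder[of ?d "T ?a f" False False] M by (auto elim: computesE)
  show ?thesis
    using t1 t2 t3 t4 t5 t6 t7 len E unfolding computes_def
    by (subst call_prog) (simp add: entry_body_def entry_join_body_def join_entry_def)
qed

lemma computes_union_entry:
  assumes len: "length a = n" "length f = n"
    and M: "\<And>a f. length (T a f) = M"
    and E: "200 * (n + 3) + (M + 1) * (40 * M + 80) \<le> E"
  shows "computes 13
    [enc_list [enc_nat 3, enc_table T n [] [], enc_table T' n [] [], enc_nat M], bits a, bits f]
    (bits (union_entry M T T' a f)) E"
proof -
  define K where "K = (M + 1) * (40 * M + 80)"
  obtain t1 where t1: "t1 \<le> 40 * n + 40"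
    "call prog 12 [enc_table T n [] [], bits a, bits f] = Some (bits (T a f), t1)"
    using computes_lookup_table[of a n f T] len by (auto elim: computesE)
  obtain t2 where t2: "t2 \<le> 40 * n + 40"
    "call prog 12 [enc_table T' n [] [], bits a, bits f] = Some (bits (T' a f), t2)"
    using computes_lookup_table[of a n f T'] len by (auto elim: computesE)
  have "computes 11 [enc_nat M, bits (T a f), bits (T' a f)] (bits (union_entry M T T' a f)) K"
    using computes_muladd[of "replicate M False" "T a f" "T' a f"] M[of a f]
    by (simp add: enc_nat_eq_bits union_entry_def K_def del: mult_Suc add_mult_distrib)
  then obtain t3 where t3: "t3 \<le> K"
    "call prog 11 [enc_nat M, bits (T a f), bits (T' a f)] = Some (bits (union_entry M T T' a f), t3)"
    by (rule computesE)
  show ?thesis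
    using t1 t2 t3 len E[folded K_def] unfolding computes_def
    by (subst call_prog) (simp add: entry_body_def entry_union_body_def)
qed

section \<open>The table of an expression and the time to build it\<close>

lemma num_exp_simps: "num_exp 0 = Empty" "num_exp 1 = Cell Empty Empty"
  "num_exp (numeral k) = Cell Empty (num_exp (pred_numeral k))"
  "num_exp (Suc n) = Cell Empty (num_exp n)"
  by (simp_all add: num_exp_def numeral_eq_Suc)

text \<open>The list \<open>labs\<close> fixes the positions of the labels in the vectors,
  \<open>M\<close> is the length of every entry, \<open>X\<close> and \<open>Y\<close> are the
  numbers substituted for the two variables, and \<open>rs\<close> and \<open>bs\<close> are the
  colour vectors.\<close>

locale tables =
  fixes labs :: "nat list" and M :: nat and X Y rs bs :: "bool list"
begin

fun table :: "cw_expr \<Rightarrow> table" where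
  "table (Create v l) = create_entry M X (index_of labs l) (rs ! v) (if bs ! v then Y else [True])"
| "table (Rename l l' e) = rename_entry (index_of labs l) (index_of labs l') (table e)"
| "table (Join l l' e) = join_entry (index_of labs l') (index_of labs l)
     (join_entry (index_of labs l) (index_of labs l') (table e))"
| "table (Disj_Union e e') = union_entry M (table e) (table e')"

lemma length_table: "length (table e a f) = M"
  by (induction e arbitrary: a f)
    (simp_all add: create_entry_def rename_entry_def join_entry_def union_entry_def Let_def)

definition params :: tree where
  "params = enc_list [enc_labels labs, enc_nat M, bits X, bits Y, bits rs, bits bs]"

text \<open>The parameters \<open>I\<close>, \<open>E\<close>, \<open>B\<close> and \<open>N\<close>
  bound an index computation, an entry, a whole table and an access to a colour vector.
  \<open>Q\<close> bounds one operation: a join builds two tables and computes two indices, and a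
  creation reads two colours.\<close>

lemma computes_table:
  assumes I: "(length labs + 1) * (20 * cw + 60) \<le> I"
    and E: "300 * (length labs + M + 3) + (M + 1) * (40 * M + 80) \<le> E"
    and B: "4 ^ length labs * (E + 100) \<le> B"
    and N: "20 * length rs + 20 \<le> N"
    and Q: "2 * B + 2 * I + 2 * N + 200 \<le> Q"
    and len: "length bs = length rs"
    and "cw_wf cw e" "expr_labels e \<subseteq> set labs" "cw_verts e \<subseteq> {..<length rs}"
  shows "computes 15 [enc_cw e, params] (enc_table (table e) (length labs) [] []) (cw_length e * Q)"
  using assms(7-)
proof (induction e)
  have index: "computes 7 [enc_labels labs, enc_nat l] (enc_nat (index_of labs l)) I" if "l \<le> cw" for l
  proof (rule computes_mono[OF computes_index])
    show "(length labs + 1) * (20 * l + 60) \<le> I"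
      using that by (intro order_trans[OF _ I] mult_le_mono) auto
  qed
  have build: "computes 14 [enc_labels labs, s, Leaf, Leaf] (enc_table T (length labs) [] []) B"
    if "\<And>a f. length a = length labs \<Longrightarrow> length f = length labs \<Longrightarrow>
      computes 13 [s, bits a, bits f] (bits (T a f)) E" for s T
    using computes_mono[OF computes_build_table[OF that] B] by blast
  have E1: "300 * (length labs + M + 3) \<le> E" using E by (rule add_leD1)
  {
    case (Create v l)
    let ?i = "index_of labs l" and ?y = "if bs ! v then Y else [True]"
    let ?s = "enc_list [enc_nat 0, enc_nat ?i, enc_bool (rs ! v), bits ?y, enc_nat M, bits X]"
    have "computes 14 [enc_labels labs, ?s, Leaf, Leaf] (enc_table (table (Create v l)) (length labs) [] []) B"
      unfolding table.simps
      by (rule build, rule computes_create_entry) (use Create E1 in \<open>auto simp: index_of_less\<close>)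
    then obtain t4 where t4: "t4 \<le> B"
      "call prog 14 [enc_labels labs, ?s, Leaf, Leaf] =
        Some (enc_table (table (Create v l)) (length labs) [] [], t4)"
      by (rule computesE)
    obtain t1 where t1: "t1 \<le> I" "call prog 7 [enc_labels labs, enc_nat l] = Some (enc_nat ?i, t1)"
      using index[of l] Create by (auto elim: computesE)
    have N': "20 * v + 20 \<le> N" using Create N by simp
    obtain t2 where t2: "t2 \<le> 20 * v + 20" "call prog 8 [bits rs, enc_nat v] = Some (enc_bool (rs ! v), t2)"
      using computes_nth[of v rs] Create by (auto elim: computesE)
    obtain t3 where t3: "t3 \<le> 20 * v + 20" "call prog 8 [bits bs, enc_nat v] = Some (enc_bool (bs ! v), t3)"
      using computes_nth[of v bs] Create len by (auto elim: computesE)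
    show ?case
      using t1 t2 t3 t4 Q N' unfolding computes_def
      by (subst call_prog)
        (cases "bs ! v"; simp del: table.simps add: table_body_def params_def num_exp_simps)
  next
    case (Rename l l' e)
    let ?i = "index_of labs l" and ?j = "index_of labs l'"
    let ?s = "enc_list [enc_nat 1, enc_nat ?i, enc_nat ?j, enc_table (table e) (length labs) [] []]"
    have "computes 14 [enc_labels labs, ?s, Leaf, Leaf] (enc_table (table (Rename l l' e)) (length labs) [] []) B"
      unfolding table.simps
      by (rule build, rule computes_rename_entry) (use Rename E1 in \<open>auto simp: index_of_less\<close>)
    then obtain t4 where t4: "t4 \<le> B"
      "call prog 14 [enc_labels labs, ?s, Leaf, Leaf] =
        Some (enc_table (table (Rename l l' e)) (length labs) [] [], t4)"
      by (rule computesE)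
    obtain t1 where t1: "t1 \<le> I" "call prog 7 [enc_labels labs, enc_nat l] = Some (enc_nat ?i, t1)"
      using index[of l] Rename.prems by (auto elim: computesE)
    obtain t2 where t2: "t2 \<le> I" "call prog 7 [enc_labels labs, enc_nat l'] = Some (enc_nat ?j, t2)"
      using index[of l'] Rename.prems by (auto elim: computesE)
    obtain t3 where t3: "t3 \<le> cw_length e * Q"
      "call prog 15 [enc_cw e, params] = Some (enc_table (table e) (length labs) [] [], t3)"
      using Rename by (auto elim: computesE)
    show ?case
      using t1 t2 t3[unfolded params_def] t4 Q unfolding computes_def
      by (subst call_prog) (simp del: table.simps add: table_body_def params_def num_exp_simps)
  next
    case (Join l l' e)
    let ?i = "index_of labs l" and ?j = "index_of labs l'"
    let ?T = "join_entry ?i ?j (table e)"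
    let ?s = "enc_list [enc_nat 2, enc_nat ?i, enc_nat ?j, enc_table (table e) (length labs) [] []]"
    let ?s' = "enc_list [enc_nat 2, enc_nat ?j, enc_nat ?i, enc_table ?T (length labs) [] []]"
    have "computes 14 [enc_labels labs, ?s, Leaf, Leaf] (enc_table ?T (length labs) [] []) B"
      by (rule build, rule computes_join_entry)
        (use Join E1 in \<open>auto simp: index_of_less length_table\<close>)
    then obtain t4 where t4: "t4 \<le> B"
      "call prog 14 [enc_labels labs, ?s, Leaf, Leaf] = Some (enc_table ?T (length labs) [] [], t4)"
      by (rule computesE)
    have "computes 14 [enc_labels labs, ?s', Leaf, Leaf] (enc_table (table (Join l l' e)) (length labs) [] []) B"
      unfolding table.simps
      by (rule build, rule computes_join_entry)
        (use Join E1 in \<open>auto simp: index_of_less length_table join_entry_def[of _ _ "table e"]\<close>)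
    then obtain t5 where t5: "t5 \<le> B"
      "call prog 14 [enc_labels labs, ?s', Leaf, Leaf] =
        Some (enc_table (table (Join l l' e)) (length labs) [] [], t5)"
      by (rule computesE)
    obtain t1 where t1: "t1 \<le> I" "call prog 7 [enc_labels labs, enc_nat l] = Some (enc_nat ?i, t1)"
      using index[of l] Join.prems by (auto elim: computesE)
    obtain t2 where t2: "t2 \<le> I" "call prog 7 [enc_labels labs, enc_nat l'] = Some (enc_nat ?j, t2)"
      using index[of l'] Join.prems by (auto elim: computesE)
    obtain t3 where t3: "t3 \<le> cw_length e * Q"
      "call prog 15 [enc_cw e, params] = Some (enc_table (table e) (length labs) [] [], t3)"
      using Join by (auto elim: computesE)
    show ?case
      using t1 t2 t3[unfolded params_def] t4 t5 Q unfolding computes_def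
      by (subst call_prog) (simp del: table.simps add: table_body_def params_def num_exp_simps)
  next
    case (Disj_Union e1 e2)
    let ?s = "enc_list [enc_nat 3, enc_table (table e1) (length labs) [] [],
      enc_table (table e2) (length labs) [] [], enc_nat M]"
    have "computes 14 [enc_labels labs, ?s, Leaf, Leaf]
      (enc_table (table (Disj_Union e1 e2)) (length labs) [] []) B"
      unfolding table.simps
      by (rule build, rule computes_union_entry) (use E in \<open>auto simp: length_table\<close>)
    then obtain t4 where t4: "t4 \<le> B"
      "call prog 14 [enc_labels labs, ?s, Leaf, Leaf] =
        Some (enc_table (table (Disj_Union e1 e2)) (length labs) [] [], t4)"
      by (rule computesE)
    obtain t1 where t1: "t1 \<le> cw_length e1 * Q"
      "call prog 15 [enc_cw e1, params] = Some (enc_table (table e1) (length labs) [] [], t1)"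
      using Disj_Union by (auto elim: computesE)
    obtain t2 where t2: "t2 \<le> cw_length e2 * Q"
      "call prog 15 [enc_cw e2, params] = Some (enc_table (table e2) (length labs) [] [], t2)"
      using Disj_Union by (auto elim: computesE)
    show ?case
      using t1[unfolded params_def] t2[unfolded params_def] t4 Q unfolding computes_def
      by (subst call_prog)
        (simp del: table.simps add: table_body_def params_def num_exp_simps add_mult_distrib)
  }
qed

end

section \<open>Reading the answer off the final entry, and the main function\<close>

lemma computes_anyset:
  "computes 16 [bits xs, enc_nat m] (enc_bool (True \<in> set (take m xs))) (20 * m + 20)"
proof (induction m arbitrary: xs)
  case 0
  show ?case by (simp add: computes_def call_prog anyset_body_def)
next
  case (Suc m)
  show ?case
  proof (cases xs)
    case Nil
    then show ?thesis by (simp add: computes_def call_prog anyset_body_def)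
  next
    case (Cons x xs')
    obtain t where "t \<le> 20 * m + 20"
      "call prog 16 [bits xs', enc_nat m] = Some (enc_bool (True \<in> set (take m xs')), t)"
      using Suc.IH by (rule computesE)
    then show ?thesis unfolding computes_def Cons
      by (subst call_prog) (cases x; simp add: anyset_body_def)
  qed
qed

lemma computes_drop: "computes 17 [bits xs, enc_nat m] (bits (drop m xs)) (20 * m + 20)"
proof (induction m arbitrary: xs)
  case 0
  show ?case by (simp add: computes_def call_prog drop_body_def)
next
  case (Suc m)
  obtain t where "t \<le> 20 * m + 20"
    "call prog 17 [bits (tl xs), enc_nat m] = Some (bits (drop m (tl xs)), t)"
    using Suc.IH by (rule computesE)
  then show ?case unfolding computes_def
    by (subst call_prog) (simp add: drop_body_def tl_tree_bits drop_Suc)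
qed

text \<open>If \<open>x\<close> is \<open>2 ^ m\<close> and the coefficients fit, the block of
  \<open>m\<close> bits starting at position \<open>j * m\<close> is the coefficient of
  \<open>x ^ j\<close>. A set bit in its low part witnesses a small power of
  \<open>y\<close>.\<close>

lemma computes_scan:
  "computes 18 [bits xs, enc_nat w, enc_nat m, enc_nat q]
    (enc_bool (\<exists>j<q. True \<in> set (take w (drop (j * m) xs)))) ((q + 1) * (20 * w + 20 * m + 100))"
proof (induction q arbitrary: xs)
  case 0
  show ?case by (simp add: computes_def call_prog scan_body_def)
next
  case (Suc q)
  let ?P = "\<lambda>xs q. \<exists>j<q. True \<in> set (take w (drop (j * m) xs))"
  \<comment> \<open>Block \<open>j + 1\<close> of \<open>xs\<close> is block \<open>j\<close> of
    \<open>drop m xs\<close>.\<close>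
  have *: "?P xs (Suc q) \<longleftrightarrow> True \<in> set (take w xs) \<or> ?P (drop m xs) q"
    by (auto simp: Ex_less_Suc2 add.commute)
  obtain t1 where t1: "t1 \<le> 20 * w + 20"
    "call prog 16 [bits xs, enc_nat w] = Some (enc_bool (True \<in> set (take w xs)), t1)"
    using computes_anyset by (rule computesE)
  obtain t2 where t2: "t2 \<le> 20 * m + 20"
    "call prog 17 [bits xs, enc_nat m] = Some (bits (drop m xs), t2)"
    using computes_drop by (rule computesE)
  obtain t3 where t3: "t3 \<le> (q + 1) * (20 * w + 20 * m + 100)"
    "call prog 18 [bits (drop m xs), enc_nat w, enc_nat m, enc_nat q] = Some (enc_bool (?P (drop m xs) q), t3)"
    using Suc.IH by (rule computesE)
  show ?case unfolding computes_def *
    using t1 t2 t3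
    by (subst call_prog) (cases "True \<in> set (take w xs)"; simp add: scan_body_def)
qed

text \<open>The sign bits are tested first, so the unary absolute values, which may be huge, are not
  traversed.\<close>

lemma computes_main_negative:
  assumes "k < 0 \<or> \<gamma> < 0"
  shows "computes 0 [enc_list [g, enc_int k, enc_int \<gamma>, t]] (enc_bool False) 20"
  using assms by (auto simp: computes_def call_prog main_body_def enc_int_def)

text \<open>With \<open>n = length rs\<close>, there are at most \<open>2 ^ n < 2 ^ w\<close> red
  sets and all cardinalities are below \<open>w\<close>. So \<open>w\<close> bits hold the
  coefficient of one monomial and \<open>m = w * w\<close> bits hold all powers of \<open>y\<close>
  belonging to one power of \<open>x\<close>. The numbers \<open>q\<close> and \<open>p\<close> are
  strict upper bounds, hence the successors of the budgets.\<close>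

lemma computes_main:
  fixes k \<gamma> :: nat and rs bs :: "bool list" and e :: cw_expr
  defines "w \<equiv> Suc (length rs)"
  defines "m \<equiv> w * w"
  defines "q \<equiv> min (Suc \<gamma>) w"
  defines "p \<equiv> min (Suc k) w"
  defines "labs \<equiv> collect_labels e []"
  defines "T \<equiv> tables.table labs (m * q) (replicate m False @ [True]) (replicate w False @ [True]) rs bs e"
  defines "z \<equiv> replicate (length labs) False"
  assumes labels: "computes 6 [enc_cw e, Leaf] (enc_labels labs) t1"
    and table: "computes 15 [enc_cw e, tables.params labs (m * q)
      (replicate m False @ [True]) (replicate w False @ [True]) rs bs] (enc_table T (length labs) [] []) t2"
  shows "computes 0 [enc_list [enc_list [adj, bits rs, bits bs], enc_int (int k), enc_int (int \<gamma>), enc_cw e]]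
    (enc_bool (\<exists>j<q. True \<in> set (take (w * p) (drop (j * m) (T z z)))))
    (t1 + t2 + (w + 1) * (10 * w + 30) + (m + 1) * (10 * q + 30) + (w + 1) * (10 * p + 30)
     + (q + 1) * (20 * (w * p) + 20 * m + 100) + 100 * w + 100 * m + 100 * length labs + 400)"
proof -
  obtain s1 where s1: "s1 \<le> 10 * w + 10" "call prog 1 [bits rs, Node Leaf Leaf] = Some (enc_nat w, s1)"
    using computes_append[of "map enc_bool rs" "[False]"]
    by (auto elim!: computesE simp: w_def enc_nat_eq_bits bits_def replicate_append_same)
  obtain s2 where s2: "s2 \<le> (w + 1) * (10 * w + 30)"
    "call prog 2 [enc_nat w, enc_nat w] = Some (enc_nat m, s2)"
    unfolding m_def using computes_mult by (rule computesE)
  obtain s3 where s3: "s3 \<le> 20 * w + 20"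
    "call prog 3 [Node Leaf (enc_nat \<gamma>), enc_nat w] = Some (enc_nat q, s3)"
    using computes_min[of "Suc \<gamma>" w] by (auto elim: computesE simp: q_def)
  obtain s4 where s4: "s4 \<le> (m + 1) * (10 * q + 30)"
    "call prog 2 [enc_nat m, enc_nat q] = Some (enc_nat (m * q), s4)"
    using computes_mult by (rule computesE)
  obtain s5 where s5: "s5 \<le> t1" "call prog 6 [enc_cw e, Leaf] = Some (enc_labels labs, s5)"
    using labels by (rule computesE)
  obtain s6 where s6: "s6 \<le> 10 * length labs + 10"
    "call prog 1 [enc_labels labs, Leaf] = Some (bits z, s6)"
    using computes_append[of "map enc_nat labs" "[]"]
    by (auto elim: computesE simp: z_def enc_labels_def)
  obtain s7 where s7: "s7 \<le> 10 * m + 10"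
    "call prog 1 [enc_nat m, Node (Node Leaf Leaf) Leaf] = Some (bits (replicate m False @ [True]), s7)"
    using computes_append[of "map enc_bool (replicate m False)" "[True]"]
    by (auto elim: computesE simp: enc_nat_eq_bits bits_def)
  obtain s8 where s8: "s8 \<le> 10 * w + 10"
    "call prog 1 [enc_nat w, Node (Node Leaf Leaf) Leaf] = Some (bits (replicate w False @ [True]), s8)"
    using computes_append[of "map enc_bool (replicate w False)" "[True]"]
    by (auto elim: computesE simp: enc_nat_eq_bits bits_def)
  obtain s9 where s9: "s9 \<le> t2"
    "call prog 15 [enc_cw e, enc_list [enc_labels labs, enc_nat (m * q), bits (replicate m False @ [True]),
      bits (replicate w False @ [True]), bits rs, bits bs]] = Some (enc_table T (length labs) [] [], s9)"
    using table[unfolded tables.params_def] by (rule computesE)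
  obtain s10 where s10: "s10 \<le> 40 * length labs + 40"
    "call prog 12 [enc_table T (length labs) [] [], bits z, bits z] = Some (bits (T z z), s10)"
    using computes_lookup_table[of z "length labs" z T] by (auto elim: computesE simp: z_def)
  obtain s11 where s11: "s11 \<le> 20 * w + 20"
    "call prog 3 [Node Leaf (enc_nat k), enc_nat w] = Some (enc_nat p, s11)"
    using computes_min[of "Suc k" w] by (auto elim: computesE simp: p_def)
  obtain s12 where s12: "s12 \<le> (w + 1) * (10 * p + 30)"
    "call prog 2 [enc_nat w, enc_nat p] = Some (enc_nat (w * p), s12)"
    using computes_mult by (rule computesE)
  obtain s13 where s13: "s13 \<le> (q + 1) * (20 * (w * p) + 20 * m + 100)"
    "call prog 18 [bits (T z z), enc_nat (w * p), enc_nat m, enc_nat q] =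
      Some (enc_bool (\<exists>j<q. True \<in> set (take (w * p) (drop (j * m) (T z z)))), s13)"
    using computes_scan by (rule computesE)
  note calls = s1(2) s2(2) s3(2) s4(2) s5(2) s6(2) s7(2) s8(2) s9(2) s10(2) s11(2) s12(2) s13(2)
  note bounds = s1(1) s2(1) s3(1) s4(1) s5(1) s6(1) s7(1) s8(1) s9(1) s10(1) s11(1) s12(1) s13(1)
  have "computes 0 [enc_list [enc_list [adj, bits rs, bits bs], enc_int (int k), enc_int (int \<gamma>), enc_cw e]]
      (enc_bool (\<exists>j<q. True \<in> set (take (w * p) (drop (j * m) (T z z)))))
      (s1 + s2 + s3 + s4 + s5 + s6 + s7 + s8 + s9 + s10 + s11 + s12 + s13 + 200)"
    unfolding computes_def
    by (subst call_prog)
      (simp add: main_body_def enc_int_def calls[simplified One_nat_def enc_list.simps])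
  then show ?thesis by (rule computes_mono) (use bounds in linarith)
qed

section \<open>Values of bit strings and generating functions\<close>

fun val :: "bool list \<Rightarrow> int" where
  "val [] = 0"
| "val (b # bs) = of_bool b + 2 * val bs"

lemma val_nonneg: "0 \<le> val bs"
  by (induction bs) auto

lemma val_less: "val bs < 2 ^ length bs"
  by (induction bs) auto

lemma val_replicate_False [simp]: "val (replicate n False) = 0"
  by (induction n) auto

lemma val_append: "val (xs @ ys) = val xs + 2 ^ length xs * val ys"
  by (induction xs) (auto simp: algebra_simps)

lemma val_eq_0_iff: "val bs = 0 \<longleftrightarrow> True \<notin> set bs"
proof (induction bs)
  case (Cons b bs)
  then show ?case using val_nonneg[of bs] by (cases b) auto
qed simp

lemma val_take_drop: "val (take k bs) = val bs mod 2 ^ k" "val (drop k bs) = val bs div 2 ^ k"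
proof -
  have *: "val (take k bs) = val bs mod 2 ^ k \<and> val (drop k bs) = val bs div 2 ^ k"
  proof (cases "k \<le> length bs")
    case True
    have "val bs = val (take k bs) + 2 ^ k * val (drop k bs)"
      using val_append[of "take k bs" "drop k bs"] True by simp
    moreover have "val (take k bs) < 2 ^ k" using val_less[of "take k bs"] True by simp
    ultimately show ?thesis using val_nonneg[of "take k bs"] by simp
  next
    case False
    then have "val bs < 2 ^ k"
      using val_less[of bs] power_increasing[of "length bs" k "2::int"] by linarith
    with False show ?thesis using val_nonneg[of bs] by simp
  qed
  from * show "val (take k bs) = val bs mod 2 ^ k" "val (drop k bs) = val bs div 2 ^ k" by blast+
qed

text \<open>Reduction modulo an even number leaves the lowest bit alone; this is the induction step
  of \<open>val_adder\<close>.\<close>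

lemma bit_mod_double: "(of_bool b + 2 * z) mod (2 * 2 ^ n) = of_bool b + 2 * (z mod 2 ^ n)" for z :: int
  using zmod_zmult2_eq[of "2 ^ n" "of_bool b + 2 * z" 2] by (cases b) auto

text \<open>In two's complement, an infinite string of negated bits of \<open>b\<close> represents \<open>- 1 - b\<close>;
  hence the flag \<open>s\<close> turns addition with carry into subtraction.\<close>

lemma val_adder:
  "val (adder a b c s) =
    (val a + (if s then - 1 - val b else val b) + of_bool c) mod 2 ^ length a"
proof (induction a arbitrary: b c)
  case (Cons x a)
  define N where "N = (\<lambda>b. if s then - 1 - val b else val b)"
  define y where "y = ((if b = [] then False else hd b) \<noteq> s)"
  define c' where "c' = (if x = y then x else c)"
  \<comment> \<open>The empty string is a fixed point of this recursion: it stands for 0 and, under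
    the flag, for \<open>- 1 = 1 + 2 * (- 1)\<close>, the infinite string of ones.\<close>
  have b: "N b = of_bool y + 2 * N (tl b)"
    by (cases b) (auto simp: N_def y_def)
  have "val (adder (x # a) b c s) = of_bool (x \<noteq> (y \<noteq> c)) + 2 * val (adder a (tl b) c' s)"
    by (simp only: adder.simps Let_def val.simps y_def[symmetric] c'_def)
  also have "\<dots> = of_bool (x \<noteq> (y \<noteq> c)) + 2 * ((val a + N (tl b) + of_bool c') mod 2 ^ length a)"
    by (simp add: Cons.IH N_def)
  also have "\<dots> = (of_bool (x \<noteq> (y \<noteq> c)) + 2 * (val a + N (tl b) + of_bool c')) mod 2 ^ length (x # a)"
    by (simp only: bit_mod_double list.size power_Suc add_0_right add_Suc_right)
  \<comment> \<open>The full-adder identity: equal bits determine the outgoing carry, and unequal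
    bits pass the incoming carry on.\<close>
  also have "of_bool (x \<noteq> (y \<noteq> c)) + 2 * (val a + N (tl b) + of_bool c') = val (x # a) + N b + of_bool c"
    unfolding b c'_def by auto
  finally show ?case by (simp add: N_def)
qed simp

lemma val_muladd: "val (muladd z a b) = (val z + val a * val b) mod 2 ^ length z"
proof (induction z a b rule: muladd.induct)
  case (1 z b)
  show ?case using val_nonneg[of z] val_less[of z] by simp
next
  case (2 z x a b)
  show ?case
  proof (cases x)
    case True
    have "val (muladd z (x # a) b) = (val (adder z b False False) + val a * (2 * val b)) mod 2 ^ length z"
      using 2 True by simp
    also have "\<dots> = (val z + val b + val a * (2 * val b)) mod 2 ^ length z"
      by (simp add: val_adder mod_add_left_eq)
    finally show ?thesis using True by (simp add: algebra_simps)
  qed (use 2 in \<open>simp add: algebra_simps\<close>)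
qed

section \<open>Generating functions of partially dominating sets\<close>

locale domination_count =
  fixes R B :: "nat set" and x y :: int
begin

definition undominated ::
    "nat set \<Rightarrow> (nat \<Rightarrow> nat) \<Rightarrow> (nat \<Rightarrow> nat \<Rightarrow> bool) \<Rightarrow> nat set \<Rightarrow> nat set \<Rightarrow> nat set" where
  "undominated V lab E D F = {v \<in> B \<inter> V. v \<notin> D \<and> lab v \<notin> F \<and> (\<forall>u\<in>D. \<not> E u v)}"

definition choices :: "nat set \<Rightarrow> (nat \<Rightarrow> nat) \<Rightarrow> nat set \<Rightarrow> nat set set" where
  "choices V lab C = {D. D \<subseteq> R \<inter> V \<and> (\<forall>u\<in>D. lab u \<notin> C)}"

definition gf ::
    "nat set \<Rightarrow> (nat \<Rightarrow> nat) \<Rightarrow> (nat \<Rightarrow> nat \<Rightarrow> bool) \<Rightarrow> nat set \<Rightarrow> nat set \<Rightarrow> int" where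
  "gf V lab E C F = (\<Sum>D\<in>choices V lab C. x ^ card D * y ^ card (undominated V lab E D F))"

lemma finite_choices: "finite V \<Longrightarrow> finite (choices V lab C)"
  by (rule finite_subset[of _ "Pow V"]) (auto simp: choices_def)

lemma gf_cong:
  assumes "\<And>u v. u \<in> V \<Longrightarrow> v \<in> V \<Longrightarrow> E u v \<longleftrightarrow> E' u v"
  shows "gf V lab E C F = gf V lab E' C F"
  unfolding gf_def
proof (rule sum.cong[OF refl])
  fix D assume "D \<in> choices V lab C"
  then have "E u v \<longleftrightarrow> E' u v" if "u \<in> D" "v \<in> V" for u v
    using assms that by (auto simp: choices_def)
  then have "undominated V lab E D F = undominated V lab E' D F"
    by (auto simp: undominated_def)
  then show "x ^ card D * y ^ card (undominated V lab E D F) = x ^ card D * y ^ card (undominated V lab E' D F)"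
    by simp
qed

text \<open>The empty set contributes \<open>y\<close> or 1. The set \<open>{v}\<close> dominates
  \<open>v\<close> itself and so contributes just \<open>x\<close>.\<close>

lemma gf_create:
  "gf {v} lab E C F = (if v \<in> B \<and> lab v \<notin> F then y else 1) + (if v \<in> R \<and> lab v \<notin> C then x else 0)"
proof -
  have ch: "choices {v} lab C = (if v \<in> R \<and> lab v \<notin> C then {{}, {v}} else {{}})"
    by (auto simp: choices_def)
  have 1: "undominated {v} lab E {} F = (if v \<in> B \<and> lab v \<notin> F then {v} else {})"
    by (auto simp: undominated_def)
  have 2: "undominated {v} lab E {v} F = {}"
    by (auto simp: undominated_def)
  show ?thesis by (simp add: gf_def ch 1 2)
qed

lemma gf_rename:
  "gf V (\<lambda>u. if lab u = l then l' else lab u) E C F =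
    gf V lab E {m. (if m = l then l' else m) \<in> C} {m. (if m = l then l' else m) \<in> F}"
  by (simp add: gf_def choices_def undominated_def)

text \<open>For the sets in \<open>?H\<close>, which avoid \<open>l\<close>, the new edges are void.
  Any other set contains a vertex labelled \<open>l\<close>, which now dominates everything labelled
  \<open>l'\<close>. Those sets form the difference of \<open>?A\<close> and \<open>?H\<close>,
  which explains the negative term.\<close>

lemma gf_join:
  assumes "finite V"
  shows "gf V lab (\<lambda>u v. E u v \<or> lab u = l \<and> lab v = l') C F =
    gf V lab E C (insert l' F) - gf V lab E (insert l C) (insert l' F) + gf V lab E (insert l C) F"
proof -
  let ?E = "\<lambda>u v. E u v \<or> lab u = l \<and> lab v = l'"
  let ?A = "choices V lab C" and ?H = "choices V lab (insert l C)"
  let ?t = "\<lambda>E F D. x ^ card D * y ^ card (undominated V lab E D F)"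
  have fin: "finite ?A" by (rule finite_choices[OF assms])
  have sub: "?H \<subseteq> ?A" by (auto simp: choices_def)
  have miss: "undominated V lab ?E D F = undominated V lab E D F" if "D \<in> ?H" for D
    using that by (auto simp: undominated_def choices_def)
  have hit: "undominated V lab ?E D F = undominated V lab E D (insert l' F)" if "D \<in> ?A - ?H" for D
    using that by (auto simp: undominated_def choices_def)
  have "gf V lab ?E C F = sum (?t ?E F) (?A - ?H) + sum (?t ?E F) ?H"
    unfolding gf_def by (rule sum.subset_diff[OF sub fin])
  also have "\<dots> = sum (?t E (insert l' F)) (?A - ?H) + sum (?t E F) ?H"
    using miss hit by simp
  also have "sum (?t E (insert l' F)) (?A - ?H) = sum (?t E (insert l' F)) ?A - sum (?t E (insert l' F)) ?H"
    by (rule sum_diff[OF fin sub])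
  finally show ?thesis by (simp add: gf_def)
qed

text \<open>A choice in the union is a pair of choices, and both exponents are additive because no
  edge crosses. Avoiding \<open>C\<close> and being exempt through \<open>F\<close> are conditions
  on single vertices, so both factors use the same \<open>C\<close> and \<open>F\<close>.\<close>

lemma gf_union:
  assumes fin: "finite V1" "finite V2" and disj: "V1 \<inter> V2 = {}"
    and lab: "\<And>v. v \<in> V1 \<Longrightarrow> lab v = lab1 v" "\<And>v. v \<in> V2 \<Longrightarrow> lab v = lab2 v"
    and E: "\<And>u v. u \<in> V1 \<Longrightarrow> v \<in> V1 \<Longrightarrow> E u v \<longleftrightarrow> E1 u v" "\<And>u v. u \<in> V2 \<Longrightarrow> v \<in> V2 \<Longrightarrow> E u v \<longleftrightarrow> E2 u v"
    and cross: "\<And>u v. u \<in> V1 \<Longrightarrow> v \<in> V2 \<Longrightarrow> \<not> E u v \<and> \<not> E v u"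
  shows "gf (V1 \<union> V2) lab E C F = gf V1 lab1 E1 C F * gf V2 lab2 E2 C F"
proof -
  let ?A1 = "choices V1 lab1 C" and ?A2 = "choices V2 lab2 C"
  have sub: "D1 \<subseteq> V1" "D2 \<subseteq> V2" if "D1 \<in> ?A1" "D2 \<in> ?A2" for D1 D2
    using that by (auto simp: choices_def)
  have factor: "x ^ card (D1 \<union> D2) * y ^ card (undominated (V1 \<union> V2) lab E (D1 \<union> D2) F) =
      (x ^ card D1 * y ^ card (undominated V1 lab1 E1 D1 F)) *
      (x ^ card D2 * y ^ card (undominated V2 lab2 E2 D2 F))"
    if D: "D1 \<in> ?A1" "D2 \<in> ?A2" for D1 D2
  proof -
    note s = sub[OF D]
    have "card (D1 \<union> D2) = card D1 + card D2"
      using s fin disj by (intro card_Un_disjoint) (auto intro: finite_subset)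
    moreover have "undominated (V1 \<union> V2) lab E (D1 \<union> D2) F =
        undominated V1 lab1 E1 D1 F \<union> undominated V2 lab2 E2 D2 F"
    proof (rule set_eqI)
      fix v
      have v1: "v \<notin> D2" "v \<notin> V2" "(\<forall>u\<in>D1 \<union> D2. \<not> E u v) \<longleftrightarrow> (\<forall>u\<in>D1. \<not> E1 u v)" if "v \<in> V1"
        using that s disj E(1)[of _ v] cross[of v] by blast+
      have v2: "v \<notin> D1" "v \<notin> V1" "(\<forall>u\<in>D1 \<union> D2. \<not> E u v) \<longleftrightarrow> (\<forall>u\<in>D2. \<not> E2 u v)" if "v \<in> V2"
        using that s disj E(2)[of _ v] cross[of _ v] by blast+
      show "v \<in> undominated (V1 \<union> V2) lab E (D1 \<union> D2) F \<longleftrightarrow>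
          v \<in> undominated V1 lab1 E1 D1 F \<union> undominated V2 lab2 E2 D2 F"
        using lab[of v] v1 v2 by (cases "v \<in> V1"; cases "v \<in> V2") (auto simp: undominated_def)
    qed
    moreover have "card (undominated V1 lab1 E1 D1 F \<union> undominated V2 lab2 E2 D2 F) =
        card (undominated V1 lab1 E1 D1 F) + card (undominated V2 lab2 E2 D2 F)"
      using fin disj by (intro card_Un_disjoint) (auto simp: undominated_def)
    ultimately show ?thesis by (simp add: power_add)
  qed
  have "gf V1 lab1 E1 C F * gf V2 lab2 E2 C F = (\<Sum>(D1, D2)\<in>?A1 \<times> ?A2.
      (x ^ card D1 * y ^ card (undominated V1 lab1 E1 D1 F)) *
      (x ^ card D2 * y ^ card (undominated V2 lab2 E2 D2 F)))"
    unfolding gf_def by (simp add: sum_product sum.cartesian_product)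
  also have "\<dots> = gf (V1 \<union> V2) lab E C F"
    unfolding gf_def
  proof (rule sum.reindex_bij_witness[of _ "\<lambda>D. (D \<inter> V1, D \<inter> V2)" "\<lambda>(D1, D2). D1 \<union> D2"])
    fix D assume "D \<in> choices (V1 \<union> V2) lab C"
    then show "(case (D \<inter> V1, D \<inter> V2) of (D1, D2) \<Rightarrow> D1 \<union> D2) = D"
      and "(D \<inter> V1, D \<inter> V2) \<in> ?A1 \<times> ?A2"
      using lab by (auto simp: choices_def)
  next
    fix P assume P: "P \<in> ?A1 \<times> ?A2"
    then obtain D1 D2 where D: "P = (D1, D2)" "D1 \<in> ?A1" "D2 \<in> ?A2" by auto
    note s = sub[OF D(2,3)]
    show "((case P of (D1, D2) \<Rightarrow> D1 \<union> D2) \<inter> V1, (case P of (D1, D2) \<Rightarrow> D1 \<union> D2) \<inter> V2) = P"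
      using s disj D(1) by auto
    show "(case P of (D1, D2) \<Rightarrow> D1 \<union> D2) \<in> choices (V1 \<union> V2) lab C"
      using D lab s by (auto simp: choices_def subset_iff)
    show "x ^ card (case P of (D1, D2) \<Rightarrow> D1 \<union> D2) *
        y ^ card (undominated (V1 \<union> V2) lab E (case P of (D1, D2) \<Rightarrow> D1 \<union> D2) F) =
      (case P of (D1, D2) \<Rightarrow> (x ^ card D1 * y ^ card (undominated V1 lab1 E1 D1 F)) *
        (x ^ card D2 * y ^ card (undominated V2 lab2 E2 D2 F)))"
      using factor[OF D(2,3)] D(1) by simp
  qed
  finally show ?thesis by simp
qed

end

section \<open>Correctness of the tables\<close>

text \<open>In a disjoint union this confines every edge to one side and yields the premise
  \<open>cross\<close> of \<open>gf_union\<close>.\<close>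

lemma cw_edges_subset: "d \<in> cw_edges e \<Longrightarrow> d \<subseteq> cw_verts e"
  by (induction e) auto

lemma finite_cw_verts: "finite (cw_verts e)"
  by (induction e) auto

definition decode :: "nat list \<Rightarrow> bool list \<Rightarrow> nat set" where
  "decode labs a = {l \<in> set labs. a ! index_of labs l}"

lemma index_of_inj: "l \<in> set labs \<Longrightarrow> m \<in> set labs \<Longrightarrow> index_of labs l = index_of labs m \<longleftrightarrow> l = m"
  by (metis nth_index_of)

lemma decode_update:
  assumes "l \<in> set labs" "length a = length labs"
  shows "decode labs (a[index_of labs l := True]) = insert l (decode labs a)"
proof (rule set_eqI)
  fix m
  show "m \<in> decode labs (a[index_of labs l := True]) \<longleftrightarrow> m \<in> insert l (decode labs a)"
    using assms index_of_less[OF assms(1)] index_of_inj[of m labs l]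
    by (auto simp: decode_def nth_list_update)
qed

lemma decode_rename:
  assumes "l \<in> set labs" "l' \<in> set labs" "length a = length labs"
  shows "decode labs (a[index_of labs l := a ! index_of labs l']) =
    {m. (if m = l then l' else m) \<in> decode labs a}"
proof (rule set_eqI)
  fix m
  show "m \<in> decode labs (a[index_of labs l := a ! index_of labs l']) \<longleftrightarrow>
      m \<in> {m. (if m = l then l' else m) \<in> decode labs a}"
    using assms index_of_less[OF assms(1)] index_of_inj[of m labs l]
    by (auto simp: decode_def nth_list_update)
qed

lemma decode_replicate_False: "decode labs (replicate (length labs) False) = {}"
  using index_of_less by (auto simp: decode_def)

abbreviation adj :: "nat set set \<Rightarrow> nat \<Rightarrow> nat \<Rightarrow> bool" where
  "adj Es u v \<equiv> {u, v} \<in> Es"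

locale correct_tables =
  tables labs M X Y rs bs + domination_count R B "val X" "val Y"
  for labs M X Y rs bs R B +
  assumes rs: "\<And>v. v < length rs \<Longrightarrow> rs ! v \<longleftrightarrow> v \<in> R"
    and bs: "\<And>v. v < length rs \<Longrightarrow> bs ! v \<longleftrightarrow> v \<in> B"
begin

text \<open>Congruence modulo \<open>2 ^ M\<close> is preserved by the sums, differences and
  products that form the entries, so intermediate signs need no care. \<open>E\<close> is an
  arbitrary relation, since after only one of the two directed joins it may be asymmetric.\<close>

definition represents ::
    "table \<Rightarrow> nat set \<Rightarrow> (nat \<Rightarrow> nat) \<Rightarrow> (nat \<Rightarrow> nat \<Rightarrow> bool) \<Rightarrow> bool" where
  "represents T V lab E \<longleftrightarrow> (\<forall>a f. length a = length labs \<longrightarrow> length f = length labs \<longrightarrow>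
     length (T a f) = M \<and> val (T a f) = gf V lab E (decode labs a) (decode labs f) mod 2 ^ M)"

lemma represents_cong:
  "represents T V lab E \<Longrightarrow> (\<And>u v. u \<in> V \<Longrightarrow> v \<in> V \<Longrightarrow> E u v \<longleftrightarrow> E' u v) \<Longrightarrow> represents T V lab E'"
  using gf_cong[of V E E'] by (simp add: represents_def)

lemma represents_join_entry:
  assumes T: "represents T V lab E" and fin: "finite V" and l: "l \<in> set labs" "l' \<in> set labs"
  shows "represents (join_entry (index_of labs l) (index_of labs l') T) V lab
    (\<lambda>u v. E u v \<or> lab u = l \<and> lab v = l')"
  unfolding represents_def
proof (intro allI impI)
  fix a f :: "bool list" assume len: "length a = length labs" "length f = length labs"
  let ?a = "a[index_of labs l := True]" and ?f = "f[index_of labs l' := True]"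
  let ?g = "\<lambda>a f. gf V lab E (decode labs a) (decode labs f)"
  have v: "length (T a f) = M" "val (T a f) = ?g a f mod 2 ^ M"
    if "length a = length labs" "length f = length labs" for a f
    using T that by (auto simp: represents_def)
  have sub_mod: "(x mod m - y mod m + z mod m) mod m = (x - y + z) mod m" for x y z m :: int
    by (intro mod_add_cong mod_diff_cong) simp_all
  \<comment> \<open>By \<open>val_adder\<close> the flag contributes \<open>- 1 - b\<close> and the
    carry contributes 1; together they subtract \<open>b\<close>.\<close>
  have "val (join_entry (index_of labs l) (index_of labs l') T a f) =
      (?g a ?f mod 2 ^ M + (- 1 - ?g ?a ?f mod 2 ^ M) + 1 + ?g ?a f mod 2 ^ M) mod 2 ^ M"
    using len by (simp add: join_entry_def val_adder v mod_add_left_eq)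
  also have "\<dots> = (?g a ?f - ?g ?a ?f + ?g ?a f) mod 2 ^ M"
    using sub_mod by simp
  also have "\<dots> = gf V lab (\<lambda>u v. E u v \<or> lab u = l \<and> lab v = l') (decode labs a) (decode labs f) mod 2 ^ M"
    by (simp add: gf_join[OF fin] decode_update l len)
  finally show "length (join_entry (index_of labs l) (index_of labs l') T a f) = M \<and>
      val (join_entry (index_of labs l) (index_of labs l') T a f) =
      gf V lab (\<lambda>u v. E u v \<or> lab u = l \<and> lab v = l') (decode labs a) (decode labs f) mod 2 ^ M"
    using len by (simp add: join_entry_def v)
qed

lemma represents_table:
  assumes "cw_wf cw e" "expr_labels e \<subseteq> set labs" "cw_verts e \<subseteq> {..<length rs}"
  shows "represents (table e) (cw_verts e) (cw_label e) (adj (cw_edges e))"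
  using assms
proof (induction e)
  case (Create v l)
  show ?case unfolding represents_def
  proof (intro allI impI conjI)
    fix a f :: "bool list" assume "length a = length labs" "length f = length labs"
    have rs': "rs ! v \<longleftrightarrow> v \<in> R" and bs': "bs ! v \<longleftrightarrow> v \<in> B" using rs bs Create by auto
    have al: "a ! index_of labs l \<longleftrightarrow> l \<in> decode labs a" "f ! index_of labs l \<longleftrightarrow> l \<in> decode labs f"
      using Create by (auto simp: decode_def)
    show "val (table (Create v l) a f) =
      gf (cw_verts (Create v l)) (cw_label (Create v l)) (adj (cw_edges (Create v l)))
        (decode labs a) (decode labs f) mod 2 ^ M"
      by (simp add: create_entry_def Let_def val_adder gf_create rs' bs' al mod_simps)
  qed (rule length_table)
next
  case (Rename l l' e)
  then have IH: "represents (table e) (cw_verts e) (cw_label e) (adj (cw_edges e))" by simp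
  show ?case unfolding represents_def
  proof (intro allI impI conjI)
    fix a f :: "bool list" assume len: "length a = length labs" "length f = length labs"
    have "cw_label (Rename l l' e) = (\<lambda>u. if cw_label e u = l then l' else cw_label e u)" by auto
    then show "val (table (Rename l l' e) a f) =
      gf (cw_verts (Rename l l' e)) (cw_label (Rename l l' e)) (adj (cw_edges (Rename l l' e)))
        (decode labs a) (decode labs f) mod 2 ^ M"
      using IH len Rename.prems
      by (simp add: rename_entry_def represents_def gf_rename decode_rename)
  qed (rule length_table)
next
  case (Join l l' e)
  let ?V = "cw_verts e" and ?L = "cw_label e"
  have l: "l \<in> set labs" "l' \<in> set labs" using Join.prems by auto
  have IH: "represents (table e) ?V ?L (adj (cw_edges e))" using Join by simp
  \<comment> \<open>The second directed join acts on the relation already enlarged by the first. As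
    edges are unordered pairs, the two directions together are exactly the edges added by
    \<open>Join\<close>.\<close>
  from represents_join_entry[OF represents_join_entry[OF IH finite_cw_verts l] finite_cw_verts l(2,1)]
  have "represents (table (Join l l' e)) ?V ?L
    (\<lambda>u v. (adj (cw_edges e) u v \<or> ?L u = l \<and> ?L v = l') \<or> ?L u = l' \<and> ?L v = l)" by simp
  moreover have "cw_label (Join l l' e) = ?L" by (rule ext) simp
  ultimately show ?case
    by (simp only: cw_verts.simps, elim represents_cong) (auto simp: doubleton_eq_iff)
next
  case (Disj_Union e1 e2)
  have IH: "represents (table e1) (cw_verts e1) (cw_label e1) (adj (cw_edges e1))"
    "represents (table e2) (cw_verts e2) (cw_label e2) (adj (cw_edges e2))"
    using Disj_Union by auto
  have disj: "cw_verts e1 \<inter> cw_verts e2 = {}" using Disj_Union.prems by simp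
  show ?case unfolding represents_def
  proof (intro allI impI conjI)
    fix a f :: "bool list" assume len: "length a = length labs" "length f = length labs"
    have "gf (cw_verts e1 \<union> cw_verts e2) (cw_label (Disj_Union e1 e2)) (adj (cw_edges e1 \<union> cw_edges e2))
        (decode labs a) (decode labs f) =
      gf (cw_verts e1) (cw_label e1) (adj (cw_edges e1)) (decode labs a) (decode labs f) *
      gf (cw_verts e2) (cw_label e2) (adj (cw_edges e2)) (decode labs a) (decode labs f)"
      by (rule gf_union)
        (use disj in \<open>auto simp: finite_cw_verts dest: cw_edges_subset\<close>)
    then show "val (table (Disj_Union e1 e2) a f) =
      gf (cw_verts (Disj_Union e1 e2)) (cw_label (Disj_Union e1 e2)) (adj (cw_edges (Disj_Union e1 e2)))
        (decode labs a) (decode labs f) mod 2 ^ M"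
      using IH len by (simp add: union_entry_def val_muladd represents_def mod_mult_eq)
  qed (rule length_table)
qed

end

section \<open>Reading coefficients off digit expansions\<close>

lemma digit_sum_bounds:
  fixes c :: "nat \<Rightarrow> int"
  assumes "\<And>i. i < n \<Longrightarrow> 0 \<le> c i \<and> c i < b"
  shows "0 \<le> (\<Sum>i<n. c i * b ^ i) \<and> (\<Sum>i<n. c i * b ^ i) < b ^ n"
  using assms
proof (induction n)
  case (Suc n)
  then have b: "0 \<le> b" by force
  have "c n * b ^ n + b ^ n \<le> b * b ^ n"
    using Suc.prems[of n] b mult_right_mono[of "c n + 1" b "b ^ n"] by (simp add: algebra_simps)
  moreover have "0 \<le> c n * b ^ n" using Suc.prems[of n] b by simp
  ultimately show ?case using Suc by fastforce
qed simp

lemma digit_sum_mod_div: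
  fixes c :: "nat \<Rightarrow> int"
  assumes "\<And>i. i < n \<Longrightarrow> 0 \<le> c i \<and> c i < b" and j: "j \<le> n"
  shows "(\<Sum>i<n. c i * b ^ i) mod b ^ j = (\<Sum>i<j. c i * b ^ i)"
    and "(\<Sum>i<n. c i * b ^ i) div b ^ j = (\<Sum>i<n - j. c (i + j) * b ^ i)"
proof -
  have "(\<Sum>i<n. c i * b ^ i) = (\<Sum>i<j. c i * b ^ i) + (\<Sum>i=j..<n. c i * b ^ i)"
    using sum.atLeastLessThan_concat[of 0 j n "\<lambda>i. c i * b ^ i"] j by (simp add: atLeast0LessThan)
  also have "(\<Sum>i=j..<n. c i * b ^ i) = (\<Sum>i<n - j. c (i + j) * b ^ (i + j))"
    using sum.shift_bounds_nat_ivl[of "\<lambda>i. c i * b ^ i" 0 j "n - j"] j by (simp add: atLeast0LessThan)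
  also have "\<dots> = b ^ j * (\<Sum>i<n - j. c (i + j) * b ^ i)"
    by (simp add: sum_distrib_left power_add mult_ac)
  finally have *: "(\<Sum>i<n. c i * b ^ i) = (\<Sum>i<j. c i * b ^ i) + b ^ j * (\<Sum>i<n - j. c (i + j) * b ^ i)" .
  have low: "0 \<le> (\<Sum>i<j. c i * b ^ i) \<and> (\<Sum>i<j. c i * b ^ i) < b ^ j"
    by (rule digit_sum_bounds) (use assms in auto)
  then have nz: "b ^ j \<noteq> 0" by linarith
  show "(\<Sum>i<n. c i * b ^ i) mod b ^ j = (\<Sum>i<j. c i * b ^ i)"
    and "(\<Sum>i<n. c i * b ^ i) div b ^ j = (\<Sum>i<n - j. c (i + j) * b ^ i)"
    unfolding * using low nz by simp_all
qed

text \<open>The number \<open>k d i\<close> of elements with exponents \<open>d\<close> and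
  \<open>i\<close> is at most \<open>card A\<close>, hence a digit in base \<open>y = 2 ^ w\<close>.
  Thus \<open>c d\<close> has \<open>w\<close> such digits and is itself a digit in base
  \<open>x = y ^ w\<close>, so no carries occur. Digits being nonnegative, a block of them vanishes
  only if each of them does.\<close>

lemma block_nonzero_iff:
  fixes A :: "'a set" and \<alpha> \<beta> :: "'a \<Rightarrow> nat"
  assumes A: "finite A" "card A < 2 ^ w" and bounds: "\<And>D. D \<in> A \<Longrightarrow> \<alpha> D < w" "\<And>D. D \<in> A \<Longrightarrow> \<beta> D < w"
    and q: "q \<le> w" and p: "p \<le> w" and j: "j < q"
    and N: "N = (\<Sum>D\<in>A. (2 ^ (w * w)) ^ \<alpha> D * (2 ^ w) ^ \<beta> D) mod 2 ^ (w * w * q)"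
  shows "N div 2 ^ (j * (w * w)) mod 2 ^ (w * p) \<noteq> (0 :: int) \<longleftrightarrow> (\<exists>D\<in>A. \<alpha> D = j \<and> \<beta> D < p)"
proof -
  define y :: int where "y = 2 ^ w"
  define x :: int where "x = 2 ^ (w * w)"
  have xy: "x = y ^ w" by (simp add: x_def y_def power_mult)
  define k where "k = (\<lambda>d i. card {D \<in> A. \<alpha> D = d \<and> \<beta> D = i})"
  define c where "c = (\<lambda>d. \<Sum>i<w. int (k d i) * y ^ i)"
  have "k d i \<le> card A" for d i unfolding k_def by (rule card_mono) (use A in auto)
  then have k: "int (k d i) < y" for d i
    using A(2) by (metis le_less_trans of_nat_less_numeral_power_cancel_iff y_def)
  have c: "0 \<le> c d \<and> c d < x" for d
    unfolding c_def xy by (rule digit_sum_bounds) (use k in simp)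
  have cmod: "c d mod y ^ p = (\<Sum>i<p. int (k d i) * y ^ i)" for d
    unfolding c_def by (rule digit_sum_mod_div) (use k p in simp_all)
  have inner: "(\<Sum>D | D \<in> A \<and> \<alpha> D = d. x ^ \<alpha> D * y ^ \<beta> D) = c d * x ^ d" for d
  proof -
    have "(\<Sum>D | D \<in> A \<and> \<alpha> D = d. x ^ \<alpha> D * y ^ \<beta> D) =
        (\<Sum>i<w. \<Sum>D | D \<in> {D \<in> A. \<alpha> D = d} \<and> \<beta> D = i. x ^ \<alpha> D * y ^ \<beta> D)"
      by (rule sum.group[symmetric]) (use A bounds in auto)
    also have "\<dots> = (\<Sum>i<w. \<Sum>D | D \<in> A \<and> \<alpha> D = d \<and> \<beta> D = i. x ^ d * y ^ i)"
      by (intro sum.cong) auto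
    also have "\<dots> = c d * x ^ d" by (simp add: c_def k_def sum_distrib_left sum_distrib_right mult_ac)
    finally show ?thesis .
  qed
  have "(\<Sum>D\<in>A. x ^ \<alpha> D * y ^ \<beta> D) = (\<Sum>d<w. c d * x ^ d)"
    unfolding inner[symmetric] by (rule sum.group[symmetric]) (use A bounds in auto)
  then have "N = (\<Sum>d<w. c d * x ^ d) mod x ^ q"
    using N by (simp add: x_def y_def power_mult)
  \<comment> \<open>The modulus \<open>x ^ q\<close> removes all terms whose exponent of
    \<open>x\<close> is at least \<open>q\<close>.\<close>
  then have "N = (\<Sum>d<q. c d * x ^ d)" using digit_sum_mod_div(1)[of w c x q] c q by simp
  then have "N div x ^ j = (\<Sum>d<q - j. c (d + j) * x ^ d)"
    using digit_sum_mod_div(2)[of q c x j] c j by simp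
  also have "\<dots> = c j + x * (\<Sum>d<q - j - 1. c (Suc d + j) * x ^ d)"
    using j by (cases "q - j") (simp_all add: sum.lessThan_Suc_shift sum_distrib_left mult_ac del: sum.lessThan_Suc)
  finally have "N div x ^ j mod y ^ p = (c j + x * (\<Sum>d<q - j - 1. c (Suc d + j) * x ^ d)) mod y ^ p" by simp
  \<comment> \<open>As \<open>p\<close> is at most \<open>w\<close>, the base \<open>x\<close> is a
    multiple of \<open>y ^ p\<close>, so the blocks above block \<open>j\<close> vanish modulo
    \<open>y ^ p\<close>.\<close>
  moreover obtain z where "x = y ^ p * z"
    unfolding xy using le_imp_power_dvd[OF p] by (rule dvdE)
  ultimately have "N div x ^ j mod y ^ p = c j mod y ^ p"
    by (simp add: mult.assoc)
  moreover have "(\<Sum>i<p. int (k j i) * y ^ i) = 0 \<longleftrightarrow> (\<forall>i\<in>{..<p}. int (k j i) * y ^ i = 0)"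
    by (rule sum_nonneg_eq_0_iff) (simp_all add: y_def)
  ultimately have "N div x ^ j mod y ^ p \<noteq> 0 \<longleftrightarrow> (\<exists>i<p. k j i \<noteq> 0)"
    unfolding cmod by (simp add: y_def Bex_def)
  also have "\<dots> \<longleftrightarrow> (\<exists>D\<in>A. \<alpha> D = j \<and> \<beta> D < p)"
    using A(1) by (auto simp: k_def)
  finally show ?thesis
    unfolding x_def y_def power_mult[symmetric] by (simp only: mult.commute[of "w * w" j])
qed

section \<open>Correctness and running time of the program\<close>

definition undominated_blue :: "rbgraph \<Rightarrow> nat set \<Rightarrow> nat set" where
  "undominated_blue G D = {v \<in> blue G. v \<notin> D \<and> (\<forall>u\<in>D. {u, v} \<notin> edges G)}"

text \<open>A finite infimum excludes the empty set, and in a well-order the infimum of a nonempty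
  set is attained.\<close>

lemma gamma_rb_attained:
  assumes "gamma_rb G = enat m"
  obtains D where "rb_dominating G D" "card D = m"
proof -
  let ?C = "(\<lambda>D. enat (card D)) ` {D. rb_dominating G D}"
  have "Inf ?C = enat m" using assms by (simp add: gamma_rb_def)
  moreover from this have "?C \<noteq> {}" by (metis Inf_empty enat.distinct(2) top_enat_def)
  ultimately have "enat m \<in> ?C" using wellorder_InfI[of _ ?C] by (metis ex_in_conv)
  then show ?thesis using that by auto
qed

text \<open>A deletion set may be taken to consist of exactly the blue vertices that \<open>D\<close> leaves
  undominated: it avoids \<open>D\<close>, since every vertex of \<open>D\<close> is in its own closed neighbourhood.\<close>

lemma reinforcement_yes_iff:
  assumes G: "red_blue_graph G"
  shows "rb_reinforcement_yes G k \<gamma> \<longleftrightarrow>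
    (\<exists>D\<subseteq>red G. int (card D) \<le> \<gamma> \<and> int (card (undominated_blue G D)) \<le> k)"
proof
  have fin: "finite (red G)" "finite (blue G)" and sub: "red G \<subseteq> verts G" "blue G \<subseteq> verts G"
    using G by (auto simp: red_blue_graph_def)
  {
    assume "rb_reinforcement_yes G k \<gamma>"
    then obtain S m where S: "S \<subseteq> blue G" "int (card S) \<le> k"
      and m: "gamma_rb (delete_verts G S) = enat m" "int m \<le> \<gamma>"
      by (auto simp: rb_reinforcement_yes_def)
    obtain D where D: "rb_dominating (delete_verts G S) D" "card D = m"
      using m(1) by (rule gamma_rb_attained)
    \<comment> \<open>Closed neighbourhoods only shrink under deletion, so a surviving blue vertex
      that is dominated afterwards is dominated in \<open>G\<close>.\<close>
    have "undominated_blue G D \<subseteq> S"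
      using D(1) by (fastforce simp: undominated_blue_def rb_dominating_def delete_verts_def closed_nbh_def)
    then have "card (undominated_blue G D) \<le> card S"
      using S(1) fin by (meson card_mono finite_subset)
    moreover have "D \<subseteq> red G" using D(1) by (auto simp: rb_dominating_def delete_verts_def)
    ultimately show "\<exists>D\<subseteq>red G. int (card D) \<le> \<gamma> \<and> int (card (undominated_blue G D)) \<le> k"
      using D(2) m(2) S(2) by (intro exI[of _ D]) auto
  next
    assume "\<exists>D\<subseteq>red G. int (card D) \<le> \<gamma> \<and> int (card (undominated_blue G D)) \<le> k"
    then obtain D where D: "D \<subseteq> red G" "int (card D) \<le> \<gamma>" "int (card (undominated_blue G D)) \<le> k"
      by blast
    let ?S = "undominated_blue G D"
    have "closed_nbh (delete_verts G ?S) v \<inter> D \<noteq> {}" if v: "v \<in> blue G" "v \<notin> ?S" for v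
    proof (cases "v \<in> D")
      case False
      then obtain u where u: "u \<in> D" "{u, v} \<in> edges G"
        using v by (auto simp: undominated_blue_def)
      have "u \<notin> ?S" using u by (simp add: undominated_blue_def)
      then show ?thesis using u v D(1) sub
        by (auto simp: closed_nbh_def delete_verts_def)
    qed (simp add: closed_nbh_def)
    then have "rb_dominating (delete_verts G ?S) D"
      using D(1) by (auto simp: rb_dominating_def delete_verts_def undominated_blue_def)
    then have "gamma_rb (delete_verts G ?S) \<le> enat (card D)"
      unfolding gamma_rb_def by (intro INF_lower) simp
    then obtain m where "gamma_rb (delete_verts G ?S) = enat m" "m \<le> card D"
      by (cases "gamma_rb (delete_verts G ?S)") auto
    moreover have "?S \<subseteq> blue G" by (auto simp: undominated_blue_def)
    ultimately show "rb_reinforcement_yes G k \<gamma>"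
      unfolding rb_reinforcement_yes_def using D by (intro exI[of _ ?S]) auto
  }
qed

lemma val_power: "val (replicate n False @ [True]) = 2 ^ n"
  by (simp add: val_append)

lemma decision_correct:
  fixes k \<gamma> :: nat
  assumes G: "red_blue_graph G" "verts G = {..<n}" and e: "cw_expr_of cw e G"
  defines "w \<equiv> Suc n"
  defines "labs \<equiv> collect_labels e []"
  defines "rs \<equiv> map (\<lambda>v. v \<in> red G) [0..<n]" and "bs \<equiv> map (\<lambda>v. v \<in> blue G) [0..<n]"
  defines "M \<equiv> w * w * min (Suc \<gamma>) w"
  defines "T \<equiv> tables.table labs M (replicate (w * w) False @ [True]) (replicate w False @ [True]) rs bs e"
  defines "z \<equiv> replicate (length labs) False"
  shows "(\<exists>j<min (Suc \<gamma>) w. True \<in> set (take (w * min (Suc k) w) (drop (j * (w * w)) (T z z)))) \<longleftrightarrow>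
    rb_reinforcement_yes G (int k) (int \<gamma>)"
proof -
  let ?q = "min (Suc \<gamma>) w" and ?p = "min (Suc k) w"
  let ?X = "replicate (w * w) False @ [True]" and ?Y = "replicate w False @ [True]"
  interpret correct_tables labs M ?X ?Y rs bs "red G" "blue G"
    by unfold_locales (auto simp: rs_def bs_def)
  have sub: "red G \<subseteq> {..<n}" "blue G \<subseteq> {..<n}"
    using G by (auto simp: red_blue_graph_def)
  then have fin: "finite (red G)" by (rule_tac finite_subset) auto
  have card_le: "card S \<le> n" if "S \<subseteq> {..<n}" for S
    using card_mono[OF _ that] by simp
  have E: "cw_verts e = {..<n}" "cw_edges e = edges G" "cw_wf cw e"
    using e G(2) by (auto simp: cw_expr_of_def)
  let ?\<beta> = "\<lambda>D. card (undominated_blue G D)"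
  have A: "choices {..<n} (cw_label e) {} = Pow (red G)"
    using sub by (auto simp: choices_def)
  have u: "undominated {..<n} (cw_label e) (adj (edges G)) D {} = undominated_blue G D" for D
    using sub by (auto simp: undominated_def undominated_blue_def)
  \<comment> \<open>In the entry that is read, no label is avoided and none is promised: all red
    sets are counted, and every undominated blue vertex is charged.\<close>
  have gf0: "gf {..<n} (cw_label e) (adj (edges G)) {} {} =
      (\<Sum>D\<in>Pow (red G). (2 ^ (w * w)) ^ card D * (2 ^ w) ^ ?\<beta> D)"
    using A u by (simp add: domination_count.gf_def val_power)
  have "represents (table e) (cw_verts e) (cw_label e) (adj (cw_edges e))"
    by (rule represents_table[OF E(3)]) (auto simp: E(1) labs_def set_collect_labels rs_def)
  then have N: "val (T z z) = (\<Sum>D\<in>Pow (red G). (2 ^ (w * w)) ^ card D * (2 ^ w) ^ ?\<beta> D) mod 2 ^ M"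
    using gf0 by (simp add: represents_def z_def T_def E decode_replicate_False)
  \<comment> \<open>The strict inequality comes from \<open>w\<close> being one more than the number
    of vertices.\<close>
  have "card (Pow (red G)) < 2 ^ w"
    using card_le[OF sub(1)] fin power_strict_increasing[of "card (red G)" w "2 :: nat"]
    by (simp add: card_Pow w_def)
  moreover have "card D < w" if "D \<in> Pow (red G)" for D
    using card_le[of D] that sub by (auto simp: w_def less_Suc_eq_le)
  moreover have \<beta>: "?\<beta> D < w" for D
  proof -
    have "undominated_blue G D \<subseteq> {..<n}" using sub by (auto simp: undominated_blue_def)
    from card_le[OF this] show ?thesis by (simp add: w_def)
  qed
  ultimately have block: "val (T z z) div 2 ^ (j * (w * w)) mod 2 ^ (w * ?p) \<noteq> 0 \<longleftrightarrow>
      (\<exists>D\<in>Pow (red G). card D = j \<and> ?\<beta> D < ?p)" if "j < ?q" for j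
    using block_nonzero_iff[of "Pow (red G)" w card ?\<beta> ?q ?p j "val (T z z)"] fin that N
    by (simp add: M_def)
  have "(\<exists>j<?q. True \<in> set (take (w * ?p) (drop (j * (w * w)) (T z z)))) \<longleftrightarrow>
      (\<exists>j<?q. val (T z z) div 2 ^ (j * (w * w)) mod 2 ^ (w * ?p) \<noteq> 0)"
    by (simp only: val_take_drop[symmetric] val_eq_0_iff not_not)
  also have "\<dots> \<longleftrightarrow> (\<exists>D\<in>Pow (red G). card D < ?q \<and> ?\<beta> D < ?p)"
    using block by blast
  \<comment> \<open>Capping the bounds at \<open>w\<close> changes nothing, because all these
    cardinalities are below \<open>w\<close> anyway.\<close>
  also have "\<dots> \<longleftrightarrow> (\<exists>D\<subseteq>red G. card D \<le> \<gamma> \<and> ?\<beta> D \<le> k)"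
    using card_le sub \<beta> by (auto simp: w_def less_Suc_eq_le)
  also have "\<dots> \<longleftrightarrow> rb_reinforcement_yes G (int k) (int \<gamma>)"
    by (simp add: reinforcement_yes_iff[OF G(1)])
  finally show ?thesis .
qed

section \<open>Estimating the total running time\<close>

lemma Suc_square_le_4_power: "Suc n * Suc n \<le> 4 ^ n"
proof -
  have "Suc n \<le> 2 ^ n" by (induction n) auto
  then have "Suc n * Suc n \<le> 2 ^ n * 2 ^ n" by (intro mult_le_mono)
  then show ?thesis by (simp flip: power_mult_distrib)
qed

text \<open>With \<open>s = n + len + 1\<close>, entries have at most \<open>s ^ 3\<close> bits, so
  one multiplication costs on the order of \<open>s ^ 6\<close>. There are \<open>4 ^ cw\<close>
  entries in a table, and the number of operations contributes the seventh factor.\<close>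

lemma total_time_bound:
  fixes n cw len L q p :: nat
  defines "w \<equiv> Suc n"
  defines "m \<equiv> w * w"
  defines "M \<equiv> m * q"
  defines "I \<equiv> (cw + 1) * (20 * cw + 60)"
  defines "E \<equiv> 300 * (L + M + 3) + (M + 1) * (40 * M + 80)"
  defines "Q \<equiv> 2 * (4 ^ cw * (E + 100)) + 2 * I + 2 * (20 * n + 20) + 200"
  assumes len: "1 \<le> len" and L: "L \<le> 2 * len" and q: "q \<le> w" and p: "p \<le> w"
  shows "len * (2 * I + 50) + len * Q + (w + 1) * (10 * w + 30) + (m + 1) * (10 * q + 30)
    + (w + 1) * (10 * p + 30) + (q + 1) * (20 * (w * p) + 20 * m + 100)
    + 100 * w + 100 * m + 100 * L + 400 \<le> 10000 * (4 ^ cw * (n + len + 1) ^ 7)"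
proof -
  define s where "s = n + len + 1"
  define P :: nat where "P = 4 ^ cw"
  define U where "U = P * s ^ 7"
  have s: "1 \<le> s" "w \<le> s" "len \<le> s" "L \<le> 2 * s" "q \<le> s" "p \<le> s" "n + 1 \<le> s"
    using len L q p by (auto simp: s_def w_def)
  have P: "1 \<le> P" by (simp add: P_def)
  \<comment> \<open>The quadratic cost of handling unary labels is a summand beside the
    \<open>4 ^ cw\<close> entries, not a factor on them, so \<open>4 ^ cw\<close> absorbs
    it.\<close>
  have I: "I \<le> 60 * P"
  proof -
    have "I \<le> 60 * (Suc cw * Suc cw)" by (simp add: I_def algebra_simps)
    also have "\<dots> \<le> 60 * P" unfolding P_def by (intro mult_le_mono2 Suc_square_le_4_power)
    finally show ?thesis .
  qed
  have pow: "s ^ i \<le> s ^ j" if "i \<le> j" for i j using s(1) that by (rule power_increasing[rotated])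
  have m: "m \<le> s ^ 2" unfolding m_def power2_eq_square by (intro mult_le_mono s)
  have "M \<le> s ^ 2 * s" unfolding M_def by (intro mult_le_mono m s)
  moreover have s_cube: "s ^ 3 = s ^ 2 * s" and s7: "s ^ 7 = s * s ^ 6"
    by (simp_all add: numeral_eq_Suc)
  ultimately have M: "M \<le> s ^ 3" by simp
  have pow36: "s ^ 3 \<le> s ^ 6" by (rule pow) simp
  have s3: "1 \<le> s ^ 3" "s \<le> s ^ 3" using s(1) pow[of 1 3] by auto
  have "(M + 1) * (40 * M + 80) \<le> (2 * s ^ 3) * (120 * s ^ 3)"
    by (intro mult_le_mono) (use M s3 in linarith)+
  then have "(M + 1) * (40 * M + 80) \<le> 240 * s ^ 6" by (simp flip: power_add)
  moreover have "300 * (L + M + 3) \<le> 1800 * s ^ 6"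
    using M s(1,4) s3 pow36 by simp
  ultimately have E: "E + 100 \<le> 2140 * s ^ 6"
    using one_le_power[OF s(1), of 6] unfolding E_def by linarith
  have B: "P * (E + 100) \<le> 2140 * (P * s ^ 6)"
    using mult_le_mono2[OF E, of P] by (simp add: mult_ac)
  have Ps: "P \<le> P * s ^ 6" using s(1) by simp
  have sP: "s \<le> P * s ^ 6" using P pow[of 1 6] mult_le_mono[of 1 P s "s ^ 6"] by simp
  have Q: "Q \<le> 4640 * (P * s ^ 6)"
  proof -
    define a b where "a = P * (E + 100)" and "b = P * s ^ 6"
    have "Q = 2 * a + 2 * I + 2 * (20 * n + 20) + 200" by (simp only: Q_def a_def P_def)
    moreover have "2 * a \<le> 4280 * b" using B unfolding a_def[symmetric] b_def[symmetric] by linarith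
    moreover have "2 * I \<le> 120 * b" using I Ps unfolding b_def[symmetric] by linarith
    moreover have "2 * (20 * n + 20) \<le> 40 * b" "200 \<le> 200 * b"
      using s(1,7) sP unfolding b_def[symmetric] by (simp_all del: One_nat_def)
    ultimately have "Q \<le> 4640 * b" by linarith
    then show ?thesis by (simp only: b_def)
  qed
  have "len * Q \<le> s * (4640 * (P * s ^ 6))" by (intro mult_le_mono s Q)
  then have t2: "len * Q \<le> 4640 * U" by (simp only: U_def s7 mult_ac)
  have U: "s ^ i \<le> U" "s ^ i * P \<le> U" if "i \<le> 7" for i
    unfolding U_def using mult_le_mono[OF P pow[OF that]] mult_le_mono2[OF pow[OF that], of P]
    by (simp_all add: mult.commute)
  have "len * (2 * I + 50) \<le> s * (170 * P)"
    by (intro mult_le_mono s) (use I P in linarith)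
  then have t1: "len * (2 * I + 50) \<le> 170 * U" using U(2)[of 1] by simp
  have "(w + 1) * (10 * w + 30) \<le> (2 * s) * (40 * s)"
    by (intro mult_le_mono) (use s in linarith)+
  then have t3: "(w + 1) * (10 * w + 30) \<le> 80 * U" using U(1)[of 2] by (simp add: power2_eq_square)
  have "(w + 1) * (10 * p + 30) \<le> (2 * s) * (40 * s)"
    by (intro mult_le_mono) (use s in linarith)+
  then have t4: "(w + 1) * (10 * p + 30) \<le> 80 * U" using U(1)[of 2] by (simp add: power2_eq_square)
  have s2: "1 \<le> s ^ 2" using s(1) by simp
  have "(m + 1) * (10 * q + 30) \<le> (2 * s ^ 2) * (40 * s)"
    by (intro mult_le_mono) (use s m s2 in linarith)+
  then have t5: "(m + 1) * (10 * q + 30) \<le> 80 * U" using U(1)[of 3] s_cube by (simp add: mult_ac)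
  have "w * p \<le> s ^ 2" unfolding power2_eq_square by (intro mult_le_mono s)
  then have "(q + 1) * (20 * (w * p) + 20 * m + 100) \<le> (2 * s) * (140 * s ^ 2)"
    by (intro mult_le_mono) (use s m s2 in linarith)+
  then have t6: "(q + 1) * (20 * (w * p) + 20 * m + 100) \<le> 280 * U"
    using U(1)[of 3] s_cube by (simp add: mult_ac)
  have "w \<le> U" "m \<le> U" "L \<le> 2 * U" "1 \<le> U"
    using U(1)[of 1] U(1)[of 2] s m by simp_all
  with t1 t2 t3 t4 t5 t6 have "len * (2 * I + 50) + len * Q + (w + 1) * (10 * w + 30)
    + (m + 1) * (10 * q + 30) + (w + 1) * (10 * p + 30)
    + (q + 1) * (20 * (w * p) + 20 * m + 100) + 100 * w + 100 * m + 100 * L + 400 \<le> 10000 * U"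
    by linarith
  then show ?thesis by (simp only: U_def P_def s_def)
qed

lemma cw_length_pos: "1 \<le> cw_length e"
  by (cases e) auto

lemma cw_verts_nonempty: "cw_verts e \<noteq> {}"
  by (induction e) auto

lemma answers_within_prog:
  assumes G: "red_blue_graph G" "verts G = {..<n}" and e: "cw_expr_of cw e G"
  shows "answers_within prog (enc_input G k \<gamma> e) (rb_reinforcement_yes G k \<gamma>)
    (10000 * (4 ^ cw * (n + cw_length e + 1) ^ 7))"
proof -
  let ?T = "10000 * (4 ^ cw * (n + cw_length e + 1) ^ 7)"
  have answer: "answers_within prog x b T" if "computes 0 [x] (enc_bool b) T" for x b T
    using that by (auto simp: answers_within_def computes_def call_def run_iff prog_def)
  show ?thesis
  proof (cases "k < 0 \<or> \<gamma> < 0")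
    case True
    then have "\<not> rb_reinforcement_yes G k \<gamma>" by (auto simp: reinforcement_yes_iff[OF G(1)])
    moreover have "computes 0 [enc_input G k \<gamma> e] (enc_bool False) 20"
      unfolding enc_input_def using computes_main_negative[OF True] .
    moreover have "20 \<le> ?T" using mult_le_mono[of 1 "4 ^ cw" 1 "(n + cw_length e + 1) ^ 7"] by simp
    ultimately show ?thesis by (intro answer) (auto intro: computes_mono)
  next
    case False
    then obtain k' \<gamma>' :: nat where k: "k = int k'" "\<gamma> = int \<gamma>'"
      by (metis nonneg_int_cases not_less)
    define w where "w = Suc n"
    define q where "q = min (Suc \<gamma>') w"
    define labs where "labs = collect_labels e []"
    define rs where "rs = map (\<lambda>v. v \<in> red G) [0..<n]"
    define bs where "bs = map (\<lambda>v. v \<in> blue G) [0..<n]"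
    define I where "I = (cw + 1) * (20 * cw + 60)"
    define E where "E = 300 * (length labs + w * w * q + 3) + (w * w * q + 1) * (40 * (w * w * q) + 80)"
    define Q where "Q = 2 * (4 ^ cw * (E + 100)) + 2 * I + 2 * (20 * n + 20) + 200"
    have len: "length rs = n" "length bs = n" by (simp_all add: rs_def bs_def)
    have wf: "cw_wf cw e" "cw_verts e = {..<n}" using e G(2) by (auto simp: cw_expr_of_def)
    have L: "length labs \<le> cw" "length labs \<le> 2 * cw_length e"
      using length_labels_le[of labs cw] distinct_collect_labels[of "[]" e] expr_labels_bounded[OF wf(1)]
        length_collect_labels[of e "[]"] by (auto simp: labs_def set_collect_labels)
    have t1: "computes 6 [enc_cw e, Leaf] (enc_labels labs) (cw_length e * (2 * I + 50))"
      using computes_labels[OF computes_insert_bounded order_refl wf(1), where labs = "[]"]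
      by (simp add: labs_def I_def)
    have t2: "computes 15 [enc_cw e, tables.params labs (w * w * q) X Y rs bs]
      (enc_table (tables.table labs (w * w * q) X Y rs bs e) (length labs) [] []) (cw_length e * Q)" for X Y
    proof (rule tables.computes_table)
      show "(length labs + 1) * (20 * cw + 60) \<le> I" unfolding I_def using L(1) by (intro mult_le_mono1) simp
      show "300 * (length labs + w * w * q + 3) + (w * w * q + 1) * (40 * (w * w * q) + 80) \<le> E"
        by (simp add: E_def)
      \<comment> \<open>In the exponent the number of labels is bounded by \<open>cw\<close>; inside
        \<open>E\<close> it is bounded through the length of the expression.\<close>
      show "4 ^ length labs * (E + 100) \<le> 4 ^ cw * (E + 100)"
        using L(1) by (intro mult_le_mono1 power_increasing) auto
      show "20 * length rs + 20 \<le> 20 * n + 20" by (simp add: len)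
      show "2 * (4 ^ cw * (E + 100)) + 2 * I + 2 * (20 * n + 20) + 200 \<le> Q" by (simp add: Q_def)
    qed (use wf len in \<open>auto simp: labs_def set_collect_labels\<close>)
    have "enc_input G k \<gamma> e = enc_list [enc_list [hd_tree (enc_graph G), bits rs, bits bs],
        enc_int (int k'), enc_int (int \<gamma>'), enc_cw e]"
      by (simp add: enc_input_def enc_graph_def k G(2) rs_def bs_def bits_def Let_def comp_def)
    note x = this
    note main = computes_main[where e = e and k = k' and \<gamma> = \<gamma>' and rs = rs and bs = bs, folded labs_def, unfolded len, folded w_def, folded q_def, OF t1 t2]
    note correct = decision_correct[OF G e, where k = k' and \<gamma> = \<gamma>',
        folded labs_def rs_def bs_def w_def, folded q_def]
    have "computes 0 [enc_input G k \<gamma> e] (enc_bool (rb_reinforcement_yes G k \<gamma>)) ?T"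
      unfolding x unfolding k
    proof (rule computes_mono)
      note main[unfolded correct]
      then show "computes 0 [enc_list [enc_list [hd_tree (enc_graph G), bits rs, bits bs],
        enc_int (int k'), enc_int (int \<gamma>'), enc_cw e]] (enc_bool (rb_reinforcement_yes G (int k') (int \<gamma>')))
        (cw_length e * (2 * I + 50) + cw_length e * Q + (w + 1) * (10 * w + 30) + (w * w + 1) * (10 * q + 30)
          + (w + 1) * (10 * min (Suc k') w + 30)
          + (q + 1) * (20 * (w * min (Suc k') w) + 20 * (w * w) + 100)
          + 100 * w + 100 * (w * w) + 100 * length labs + 400)" .
    next
      show "cw_length e * (2 * I + 50) + cw_length e * Q + (w + 1) * (10 * w + 30) + (w * w + 1) * (10 * q + 30)
          + (w + 1) * (10 * min (Suc k') w + 30)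
          + (q + 1) * (20 * (w * min (Suc k') w) + 20 * (w * w) + 100)
          + 100 * w + 100 * (w * w) + 100 * length labs + 400 \<le> ?T"
        using total_time_bound[of "cw_length e" "length labs" q n "min (Suc k') w" cw,
            folded w_def I_def, folded E_def, folded Q_def] cw_length_pos[of e] L(2)
        by (simp only: q_def min.cobounded2)
    qed
    then show ?thesis by (rule answer)
  qed
qed

text \<open>Renamings and joins can be repeated at will, so the length of an expression is not
  bounded in terms of \<open>n\<close>. The first conjunct therefore measures time in
  \<open>n\<close> and the length. The second derives \<open>n ^ c\<close> for expressions of
  polynomial length, with the same program for every degree \<open>d\<close>.\<close>

theorem theorem4:
  shows "\<exists>P :: program.
    (\<exists>c :: nat. \<forall>(G :: rbgraph) (k :: int) (\<gamma> :: int) (n :: nat) (cw :: nat) (e :: cw_expr).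
       rb_reinforcement_instance G k \<gamma> \<longrightarrow> verts G = {..<n} \<longrightarrow> cw_expr_of cw e G \<longrightarrow>
       answers_within P (enc_input G k \<gamma> e) (rb_reinforcement_yes G k \<gamma>)
         (c * 4 ^ cw * (n + cw_length e) ^ c)) \<and>
    (\<forall>d :: nat. \<exists>c :: nat. \<forall>(G :: rbgraph) (k :: int) (\<gamma> :: int) (n :: nat) (cw :: nat) (e :: cw_expr).
       rb_reinforcement_instance G k \<gamma> \<longrightarrow> verts G = {..<n} \<longrightarrow> cw_expr_of cw e G \<longrightarrow>
       cw_length e \<le> d * n ^ d \<longrightarrow>
       answers_within P (enc_input G k \<gamma> e) (rb_reinforcement_yes G k \<gamma>)
         (c * 4 ^ cw * n ^ c))"
proof -
  have mono: "answers_within P x b T \<Longrightarrow> T \<le> T' \<Longrightarrow> answers_within P x b T'" for P x b T T'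
    by (auto simp: answers_within_def intro: order_trans)
  have bound: "10000 * (4 ^ cw * (n + len + 1) ^ 7) \<le> (10000 * 2 ^ 7) * 4 ^ cw * (n + len) ^ 7"
    if "1 \<le> len" for n cw len :: nat
  proof -
    have "(n + len + 1) ^ 7 \<le> (2 * (n + len)) ^ 7" using that by (intro power_mono) auto
    then have "10000 * (4 ^ cw * (n + len + 1) ^ 7) \<le> 10000 * (4 ^ cw * (2 * (n + len)) ^ 7)"
      by (intro mult_le_mono2)
    then show ?thesis by (simp only: power_mult_distrib mult_ac)
  qed
  \<comment> \<open>The constant serves both as factor and as exponent, hence the fact
    \<open>7 \<le> c0\<close>.\<close>
  define c0 :: nat where "c0 = 10000 * 2 ^ 7"
  have c0: "7 \<le> c0" by (simp add: c0_def)
  have main: "answers_within prog (enc_input G k \<gamma> e) (rb_reinforcement_yes G k \<gamma>)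
      (c0 * 4 ^ cw * (n + cw_length e) ^ 7)"
    if "rb_reinforcement_instance G k \<gamma>" "verts G = {..<n}" "cw_expr_of cw e G" for G k \<gamma> n cw e
    unfolding c0_def
    by (rule mono[OF answers_within_prog bound])
      (use that cw_length_pos in \<open>auto simp: rb_reinforcement_instance_def\<close>)
  show ?thesis
  proof (rule exI[of _ prog], rule conjI)
    show "\<exists>c. \<forall>G k \<gamma> n cw e. rb_reinforcement_instance G k \<gamma> \<longrightarrow> verts G = {..<n} \<longrightarrow>
        cw_expr_of cw e G \<longrightarrow> answers_within prog (enc_input G k \<gamma> e) (rb_reinforcement_yes G k \<gamma>)
          (c * 4 ^ cw * (n + cw_length e) ^ c)"
    proof (intro exI[of _ c0] allI impI)
      fix G k \<gamma> n cw e
      assume asm: "rb_reinforcement_instance G k \<gamma>" "verts G = {..<n}" "cw_expr_of cw e G"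
      have "(n + cw_length e) ^ 7 \<le> (n + cw_length e) ^ c0"
        using c0 cw_length_pos[of e] by (intro power_increasing) auto
      then show "answers_within prog (enc_input G k \<gamma> e) (rb_reinforcement_yes G k \<gamma>)
          (c0 * 4 ^ cw * (n + cw_length e) ^ c0)"
        by (intro mono[OF main[OF asm]] mult_le_mono2)
    qed
  next
    show "\<forall>d. \<exists>c. \<forall>G k \<gamma> n cw e. rb_reinforcement_instance G k \<gamma> \<longrightarrow> verts G = {..<n} \<longrightarrow>
        cw_expr_of cw e G \<longrightarrow> cw_length e \<le> d * n ^ d \<longrightarrow>
        answers_within prog (enc_input G k \<gamma> e) (rb_reinforcement_yes G k \<gamma>) (c * 4 ^ cw * n ^ c)"
    proof
      fix d :: nat
      \<comment> \<open>The first summand covers the constant factor, the second the exponent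
        obtained by inserting the length bound into the seventh power.\<close>
      define c where "c = c0 * (d + 1) ^ 7 + (d + 1) * 7"
      show "\<exists>c. \<forall>G k \<gamma> n cw e. rb_reinforcement_instance G k \<gamma> \<longrightarrow> verts G = {..<n} \<longrightarrow>
          cw_expr_of cw e G \<longrightarrow> cw_length e \<le> d * n ^ d \<longrightarrow>
          answers_within prog (enc_input G k \<gamma> e) (rb_reinforcement_yes G k \<gamma>) (c * 4 ^ cw * n ^ c)"
      proof (intro exI[of _ c] allI impI)
        fix G k \<gamma> n cw e
        assume asm: "rb_reinforcement_instance G k \<gamma>" "verts G = {..<n}" "cw_expr_of cw e G"
          and len: "cw_length e \<le> d * n ^ d"
        \<comment> \<open>Every expression creates a vertex. Positivity is what makes the powers of
          \<open>n\<close> monotone in the exponent.\<close>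
        have "n \<noteq> 0" using asm(2,3) cw_verts_nonempty[of e] by (auto simp: cw_expr_of_def)
        then have n: "1 \<le> n" by simp
        have "n + cw_length e \<le> n ^ (d + 1) + d * n ^ (d + 1)"
          using len power_increasing[of 1 "d + 1" n] power_increasing[of d "d + 1" n] n
          by (intro add_mono) (auto intro: order_trans)
        then have "(n + cw_length e) ^ 7 \<le> ((d + 1) * n ^ (d + 1)) ^ 7"
          by (intro power_mono) (simp_all add: algebra_simps)
        also have "\<dots> = (d + 1) ^ 7 * n ^ ((d + 1) * 7)"
          by (simp only: power_mult_distrib power_mult)
        also have "\<dots> \<le> (d + 1) ^ 7 * n ^ c"
          using n by (intro mult_le_mono2 power_increasing) (simp_all add: c_def)
        finally have "c0 * 4 ^ cw * (n + cw_length e) ^ 7 \<le> c0 * 4 ^ cw * ((d + 1) ^ 7 * n ^ c)"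
          by (intro mult_le_mono2)
        also have "\<dots> = (c0 * (d + 1) ^ 7) * (4 ^ cw * n ^ c)" by (simp only: mult_ac)
        also have "\<dots> \<le> c * (4 ^ cw * n ^ c)" by (intro mult_le_mono1) (simp add: c_def)
        finally show "answers_within prog (enc_input G k \<gamma> e) (rb_reinforcement_yes G k \<gamma>) (c * 4 ^ cw * n ^ c)"
          by (intro mono[OF main[OF asm]]) (simp only: mult.assoc)
      qed
    qed
  qed
qed

end
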